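(* Let $R$ be an integral domain. Then: (1) $R$ has $t$-finite character if and only if $R\langle X\rangle$ has finite character; (2) $R$ is a weakly Matlis P$v$MD if and only if $R\langle X\rangle$ is an $h$-local Prüfer domain; (3) $R$ is a strongly discrete P$v$MD if and only if $R\langle X\rangle$ is a strongly discrete Prüfer domain; (4) $R$ is a generalized Krull domain if and only if $R\langle X\rangle$ is a generalized Dedekind domain; (5) $R$ is an integrally closed $w$-divisorial domain if and only if $R\langle X\rangle$ is an integrally closed divisorial domain; (6) $R$ is an integrally closed $w$-stable domain if and only if $R\langle X\rangle$ is an integrally closed stable domain.
   Context: $R$ is an integral domain with quotient field $K\neq R$. For nonzero submodules $A,B$ of $K$, $(A:B)=\{x\in K: xB\subseteq A\}$; $E(I)=(I:I)$. For a nonzero fractional ideal $I$, $I_v=(R:(R:I))$ ($I$ divisorial if $I=I_v$), $I_t=\bigcup\{J_v: J\subseteq I\text{ nonzero finitely generated}\}$ ($I$ a $t$-ideal if $I=I_t$); $t$-primes are prime $t$-ideals; $t\text{-Max}(R)$ is the set of ideals maximal among proper $t$-ideals. $E_w=\bigcap_{M\in t\text{-Max}(R)}ER_M$; $w$-ideals satisfy $I=I_w$. For $f\in R[X]$, $c(f)$ is the ideal generated by its coefficients, and $R\langle X\rangle=R[X]_{N_t}$ with $N_t=\{f: c(f)_t=R\}$. $R$ has ($t$-)finite character if each nonzero element lies in finitely many maximal ($t$-maximal) ideals. $R$ is weakly Matlis if it has $t$-finite character and each $t$-prime lies in a unique $t$-maximal ideal; a domain is $h$-local if it has finite character and each nonzero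 prime lies in a unique maximal ideal. $R$ is a P$v$MD if $R_M$ is a valuation domain for each $M\in t\text{-Max}(R)$; a P$v$MD is strongly discrete if $(P^2)_t\neq P$ for each $t$-prime $P$; a Prüfer domain is strongly discrete if $P\neq P^2$ for each nonzero prime $P$. A generalized Krull domain is a strongly discrete P$v$MD with the ascending chain condition on radical $t$-ideals; a generalized Dedekind domain is a strongly discrete Prüfer domain with the ascending chain condition on radical ideals. A domain is divisorial if every nonzero ideal is divisorial; $R$ is $w$-divisorial if every $w$-ideal is divisorial. A domain $D$ is stable if every nonzero ideal $I$ satisfies $I((I:I):I)=(I:I)$; $R$ is $w$-stable if every $w$-ideal $I$ satisfies $(I(E(I):I))_w=E(I)$. *)

theory Defs
  imports "HOL-Computational_Algebra.Polynomial" "HOL-Computational_Algebra.Fraction_Field"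
begin

text \<open>An integral domain is represented as a subring D of a field (type 'a);
all notions below are relative to D and its quotient field QF D inside 'a.\<close>

definition dom_in :: "'a::field set \<Rightarrow> bool" where
  "dom_in D \<longleftrightarrow> 1 \<in> D \<and> (\<forall>a\<in>D. \<forall>b\<in>D. a + b \<in> D \<and> a * b \<in> D \<and> - a \<in> D)"

definition QF :: "'a::field set \<Rightarrow> 'a set" where
  "QF D = {a / b | a b. a \<in> D \<and> b \<in> D \<and> b \<noteq> 0}"

definition span_in :: "'a::field set \<Rightarrow> 'a set \<Rightarrow> 'a set" where
  "span_in D S = {(\<Sum>s\<in>F. c s * s) | F c. finite F \<and> F \<subseteq> S \<and> (\<forall>s\<in>F. c s \<in> D)}"

definition prod_in :: "'a::field set \<Rightarrow> 'a set \<Rightarrow> 'a set \<Rightarrow> 'a set" where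
  "prod_in D A B = span_in D {a * b | a b. a \<in> A \<and> b \<in> B}"

definition colon :: "'a::field set \<Rightarrow> 'a set \<Rightarrow> 'a set \<Rightarrow> 'a set" where
  "colon D A B = {x \<in> QF D. \<forall>b\<in>B. x * b \<in> A}"

definition Eo :: "'a::field set \<Rightarrow> 'a set \<Rightarrow> 'a set" where
  "Eo D I = colon D I I"

definition v_op :: "'a::field set \<Rightarrow> 'a set \<Rightarrow> 'a set" where
  "v_op D I = colon D D (colon D D I)"

definition fg_nonzero :: "'a::field set \<Rightarrow> 'a set \<Rightarrow> bool" where
  "fg_nonzero D J \<longleftrightarrow> (\<exists>S. finite S \<and> S \<subseteq> QF D \<and> J = span_in D S) \<and> J \<noteq> {0}"

definition t_op :: "'a::field set \<Rightarrow> 'a set \<Rightarrow> 'a set" where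
  "t_op D I = \<Union>{v_op D J | J. J \<subseteq> I \<and> fg_nonzero D J}"

definition is_ideal :: "'a::field set \<Rightarrow> 'a set \<Rightarrow> bool" where
  "is_ideal D I \<longleftrightarrow> I \<subseteq> D \<and> 0 \<in> I \<and> (\<forall>a\<in>I. \<forall>b\<in>I. a + b \<in> I) \<and> (\<forall>r\<in>D. \<forall>a\<in>I. r * a \<in> I)"

definition prime_ideal :: "'a::field set \<Rightarrow> 'a set \<Rightarrow> bool" where
  "prime_ideal D P \<longleftrightarrow> is_ideal D P \<and> P \<noteq> D \<and> (\<forall>a\<in>D. \<forall>b\<in>D. a * b \<in> P \<longrightarrow> a \<in> P \<or> b \<in> P)"

definition Max_ideals :: "'a::field set \<Rightarrow> 'a set set" where
  "Max_ideals D = {M. is_ideal D M \<and> M \<noteq> D \<and> (\<forall>J. is_ideal D J \<and> J \<noteq> D \<and> M \<subseteq> J \<longrightarrow> J = M)}"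

definition t_ideal :: "'a::field set \<Rightarrow> 'a set \<Rightarrow> bool" where
  "t_ideal D I \<longleftrightarrow> is_ideal D I \<and> I \<noteq> {0} \<and> t_op D I = I"

definition t_prime :: "'a::field set \<Rightarrow> 'a set \<Rightarrow> bool" where
  "t_prime D P \<longleftrightarrow> prime_ideal D P \<and> t_ideal D P"

definition t_Max :: "'a::field set \<Rightarrow> 'a set set" where
  "t_Max D = {M. t_ideal D M \<and> M \<noteq> D \<and> (\<forall>J. t_ideal D J \<and> J \<noteq> D \<and> M \<subseteq> J \<longrightarrow> J = M)}"

definition finite_character :: "'a::field set \<Rightarrow> bool" where
  "finite_character D \<longleftrightarrow> (\<forall>x\<in>D. x \<noteq> 0 \<longrightarrow> finite {M \<in> Max_ideals D. x \<in> M})"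

definition t_finite_character :: "'a::field set \<Rightarrow> bool" where
  "t_finite_character D \<longleftrightarrow> (\<forall>x\<in>D. x \<noteq> 0 \<longrightarrow> finite {M \<in> t_Max D. x \<in> M})"

definition weakly_Matlis :: "'a::field set \<Rightarrow> bool" where
  "weakly_Matlis D \<longleftrightarrow> t_finite_character D \<and>
     (\<forall>P. t_prime D P \<longrightarrow> (\<exists>!M. M \<in> t_Max D \<and> P \<subseteq> M))"

definition h_local :: "'a::field set \<Rightarrow> bool" where
  "h_local D \<longleftrightarrow> finite_character D \<and>
     (\<forall>P. prime_ideal D P \<and> P \<noteq> {0} \<longrightarrow> (\<exists>!M. M \<in> Max_ideals D \<and> P \<subseteq> M))"

definition loc_mod :: "'a::field set \<Rightarrow> 'a set \<Rightarrow> 'a set \<Rightarrow> 'a set" where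
  "loc_mod D M I = {e / s | e s. e \<in> I \<and> s \<in> D \<and> s \<notin> M}"

definition valuation_dom :: "'a::field set \<Rightarrow> bool" where
  "valuation_dom V \<longleftrightarrow> (\<forall>x\<in>QF V. x \<noteq> 0 \<longrightarrow> x \<in> V \<or> inverse x \<in> V)"

definition PvMD :: "'a::field set \<Rightarrow> bool" where
  "PvMD D \<longleftrightarrow> (\<forall>M\<in>t_Max D. valuation_dom (loc_mod D M D))"

definition Prufer :: "'a::field set \<Rightarrow> bool" where
  "Prufer D \<longleftrightarrow> (\<forall>I. is_ideal D I \<and> fg_nonzero D I \<longrightarrow> prod_in D I (colon D D I) = D)"

definition strongly_discrete_PvMD :: "'a::field set \<Rightarrow> bool" where
  "strongly_discrete_PvMD D \<longleftrightarrow> PvMD D \<and> (\<forall>P. t_prime D P \<longrightarrow> t_op D (prod_in D P P) \<noteq> P)"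

definition strongly_discrete_Prufer :: "'a::field set \<Rightarrow> bool" where
  "strongly_discrete_Prufer D \<longleftrightarrow> Prufer D \<and>
     (\<forall>P. prime_ideal D P \<and> P \<noteq> {0} \<longrightarrow> prod_in D P P \<noteq> P)"

definition radical_in :: "'a::field set \<Rightarrow> 'a set \<Rightarrow> bool" where
  "radical_in D I \<longleftrightarrow> (\<forall>x\<in>D. \<forall>n::nat. x ^ n \<in> I \<longrightarrow> x \<in> I)"

definition acc_radical_t :: "'a::field set \<Rightarrow> bool" where
  "acc_radical_t D \<longleftrightarrow> \<not> (\<exists>f :: nat \<Rightarrow> 'a set.
      \<forall>n. t_ideal D (f n) \<and> radical_in D (f n) \<and> f n \<subset> f (Suc n))"

definition acc_radical :: "'a::field set \<Rightarrow> bool" where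
  "acc_radical D \<longleftrightarrow> \<not> (\<exists>f :: nat \<Rightarrow> 'a set.
      \<forall>n. is_ideal D (f n) \<and> radical_in D (f n) \<and> f n \<subset> f (Suc n))"

definition generalized_Krull :: "'a::field set \<Rightarrow> bool" where
  "generalized_Krull D \<longleftrightarrow> strongly_discrete_PvMD D \<and> acc_radical_t D"

definition generalized_Dedekind :: "'a::field set \<Rightarrow> bool" where
  "generalized_Dedekind D \<longleftrightarrow> strongly_discrete_Prufer D \<and> acc_radical D"

definition integrally_closed :: "'a::field set \<Rightarrow> bool" where
  "integrally_closed D \<longleftrightarrow> (\<forall>x\<in>QF D.
     (\<exists>n c. (\<forall>i<n. c i \<in> D) \<and> x ^ n + (\<Sum>i<n. c i * x ^ i) = 0) \<longrightarrow> x \<in> D)"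

definition divisorial :: "'a::field set \<Rightarrow> bool" where
  "divisorial D \<longleftrightarrow> (\<forall>I. is_ideal D I \<and> I \<noteq> {0} \<longrightarrow> v_op D I = I)"

definition w_op :: "'a::field set \<Rightarrow> 'a set \<Rightarrow> 'a set" where
  "w_op D I = {x \<in> QF D. \<forall>M\<in>t_Max D. x \<in> loc_mod D M I}"

definition w_ideal :: "'a::field set \<Rightarrow> 'a set \<Rightarrow> bool" where
  "w_ideal D I \<longleftrightarrow> is_ideal D I \<and> I \<noteq> {0} \<and> w_op D I = I"

definition w_divisorial :: "'a::field set \<Rightarrow> bool" where
  "w_divisorial D \<longleftrightarrow> (\<forall>I. w_ideal D I \<longrightarrow> v_op D I = I)"

definition stable :: "'a::field set \<Rightarrow> bool" where
  "stable D \<longleftrightarrow> (\<forall>I. is_ideal D I \<and> I \<noteq> {0} \<longrightarrow>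
      prod_in D I (colon D (Eo D I) I) = Eo D I)"

definition w_stable :: "'a::field set \<Rightarrow> bool" where
  "w_stable D \<longleftrightarrow> (\<forall>I. w_ideal D I \<longrightarrow>
      w_op D (prod_in D I (colon D (Eo D I) I)) = Eo D I)"

text \<open>Polynomials over R (viewed inside 'a poly), content, N_t and the Nagata-type
ring R<X> = R[X]_{N_t}, realised inside the field 'a poly fract.\<close>
definition poly_over :: "'a::field set \<Rightarrow> 'a poly \<Rightarrow> bool" where
  "poly_over R f \<longleftrightarrow> (\<forall>i. coeff f i \<in> R)"

definition content_ideal :: "'a::field set \<Rightarrow> 'a poly \<Rightarrow> 'a set" where
  "content_ideal R f = span_in R (range (coeff f))"

definition N_t :: "'a::field set \<Rightarrow> 'a poly set" where
  "N_t R = {f. poly_over R f \<and> f \<noteq> 0 \<and> t_op R (content_ideal R f) = R}"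

definition RX :: "'a::field set \<Rightarrow> 'a poly fract set" where
  "RX R = {Fract f g | f g. poly_over R f \<and> g \<in> N_t R}"

end

theory Submission
  imports Defs "HOL-Computational_Algebra.Polynomial_Factorial"
begin

text \<open>
  Write \<open>T\<close> for the Nagata-type ring and, for a submodule \<open>I\<close> of the quotient field, let \<open>ext I\<close> be
  the \<open>T\<close>-submodule it generates, i.e. the fractions with numerator in \<open>I[X]\<close>. Since \<open>N_t\<close> is the
  complement of the union of the primes \<open>M[X]\<close> with \<open>M\<close> a maximal t-ideal, \<open>ext I\<close> meets the quotient
  field in \<open>I_w\<close>, and a polynomial combining finitely many contents shows that the maximal ideals of
  \<open>T\<close> are exactly the \<open>ext M\<close>. If \<open>R\<close> is a PvMD, a polynomial and its content generate the same
  submodule over \<open>T\<close>; hence \<open>T\<close> is a Bezout domain and \<open>I \<mapsto> ext I\<close> is a bijection from the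
  w-ideals (equivalently, t-ideals) of \<open>R\<close> onto the nonzero ideals of \<open>T\<close> that respects primes,
  radicals, products and colons. Conversely \<open>T\<close> Pruefer forces \<open>R\<close> to be a PvMD. Finally, in the
  integrally closed case, divisoriality or stability makes a finitely generated ideal \<open>I\<close> invertible,
  because \<open>(I : I)\<close> is the ring itself; the w-versions do the same locally.
\<close>

section \<open>Submodules of a field over a subring\<close>

text \<open>The link between the t-structure of R and the units of T is a finite certificate: a
  finite set S with 1 in its v-closure. An ideal of R that lies in no maximal t-ideal contains such
  a set; if x carries it into a t-ideal, then x belongs to that t-ideal; and laying S out as the
  coefficients of a polynomial gives an element of \<open>N_t\<close>, a unit of T. For this reason
  v-closures are taken of finite sets throughout. The closure seen by T is w, whereas the items on
  PvMDs speak of t. The two are shown to agree only over a PvMD, and only there is every ideal of T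
  extended from R. Item (1) needs just the description of the maximal ideals of T.\<close>

lemma dom_in_mem:
  assumes "dom_in D"
  shows dom_one: "1 \<in> D" and dom_zero: "0 \<in> D"
    and dom_add: "a \<in> D \<Longrightarrow> b \<in> D \<Longrightarrow> a + b \<in> D"
    and dom_mult: "a \<in> D \<Longrightarrow> b \<in> D \<Longrightarrow> a * b \<in> D"
    and dom_uminus: "a \<in> D \<Longrightarrow> - a \<in> D"
    and dom_diff: "a \<in> D \<Longrightarrow> b \<in> D \<Longrightarrow> a - b \<in> D"
proof -
  show one: "1 \<in> D" using assms by (auto simp: dom_in_def)
  have add: "x \<in> D \<Longrightarrow> y \<in> D \<Longrightarrow> x + y \<in> D" and neg: "x \<in> D \<Longrightarrow> - x \<in> D" for x y
    using assms by (auto simp: dom_in_def)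
  show "a \<in> D \<Longrightarrow> b \<in> D \<Longrightarrow> a * b \<in> D" using assms by (auto simp: dom_in_def)
  show "a \<in> D \<Longrightarrow> b \<in> D \<Longrightarrow> a + b \<in> D" "a \<in> D \<Longrightarrow> - a \<in> D" by (rule add neg; assumption)+
  show "0 \<in> D" and "a \<in> D \<Longrightarrow> b \<in> D \<Longrightarrow> a - b \<in> D"
    using add[OF one neg[OF one]] add[of a "- b"] neg[of b] by auto
qed

lemma dom_power: "dom_in D \<Longrightarrow> a \<in> D \<Longrightarrow> a ^ n \<in> D"
  by (induction n) (auto intro: dom_one dom_mult)

definition submod :: "'a::field set \<Rightarrow> 'a set \<Rightarrow> bool" where
  "submod D I \<longleftrightarrow> 0 \<in> I \<and> (\<forall>a\<in>I. \<forall>b\<in>I. a + b \<in> I) \<and> (\<forall>r\<in>D. \<forall>a\<in>I. r * a \<in> I)"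

lemma submodI:
  assumes "0 \<in> I" "\<And>a b. a \<in> I \<Longrightarrow> b \<in> I \<Longrightarrow> a + b \<in> I" "\<And>r a. r \<in> D \<Longrightarrow> a \<in> I \<Longrightarrow> r * a \<in> I"
  shows "submod D I"
  using assms by (auto simp: submod_def)

lemma submod_mem:
  assumes "submod D I"
  shows submod_zero: "0 \<in> I" and submod_add: "a \<in> I \<Longrightarrow> b \<in> I \<Longrightarrow> a + b \<in> I"
    and submod_mult: "r \<in> D \<Longrightarrow> a \<in> I \<Longrightarrow> r * a \<in> I"
  using assms by (auto simp: submod_def)

lemma submod_sum:
  assumes "submod D I" "\<And>x. x \<in> A \<Longrightarrow> f x \<in> I"
  shows "sum f A \<in> I"
  using assms(2)
  by (induction A rule: infinite_finite_induct)
     (auto intro: submod_zero[OF assms(1)] submod_add[OF assms(1)])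

lemma submod_self: "dom_in D \<Longrightarrow> submod D D"
  by (auto intro!: submodI intro: dom_in_mem)

lemma is_ideal_iff: "is_ideal D I \<longleftrightarrow> I \<subseteq> D \<and> submod D I"
  by (auto simp: is_ideal_def submod_def)

lemma ideal_eq_whole:
  assumes "is_ideal D I" "1 \<in> I"
  shows "I = D"
  using assms by (force simp: is_ideal_def)

lemma QF_I: "a \<in> D \<Longrightarrow> b \<in> D \<Longrightarrow> b \<noteq> 0 \<Longrightarrow> a / b \<in> QF D"
  by (auto simp: QF_def)

lemma QF_E:
  assumes "x \<in> QF D"
  obtains a b where "a \<in> D" "b \<in> D" "b \<noteq> 0" "x = a / b"
  using assms by (auto simp: QF_def)

lemma sub_QF: "dom_in D \<Longrightarrow> D \<subseteq> QF D"
  using QF_I[of _ D 1] by (auto intro: dom_one)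

lemma dom_in_QF:
  assumes D: "dom_in D"
  shows "dom_in (QF D)"
  unfolding dom_in_def
proof (intro conjI ballI)
  show "1 \<in> QF D" using sub_QF[OF D] dom_one[OF D] by auto
  fix x y assume "x \<in> QF D" "y \<in> QF D"
  then obtain a b c d where e: "a \<in> D" "b \<in> D" "b \<noteq> 0" "x = a / b" "c \<in> D" "d \<in> D" "d \<noteq> 0" "y = c / d"
    by (auto elim!: QF_E)
  have "x + y = (a * d + c * b) / (b * d)" "x * y = (a * c) / (b * d)" "- x = (- a) / b"
    using e by (auto simp: field_simps)
  then show "x + y \<in> QF D" "x * y \<in> QF D" "- x \<in> QF D"
    using e by (simp_all only:) (intro QF_I dom_in_mem[OF D] no_zero_divisors; simp)+
qed

lemma QF_inverse: "dom_in D \<Longrightarrow> x \<in> QF D \<Longrightarrow> inverse x \<in> QF D"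
  \<comment> \<open>The case a = 0 needs \<open>0 / 1\<close>, as \<open>inverse 0\<close> is
    0.\<close>
  using QF_I[of 0 D 1]
  by (elim QF_E) (case_tac "a = 0", auto intro: QF_I dom_in_mem simp: inverse_eq_divide)

lemma QF_divide: "dom_in D \<Longrightarrow> x \<in> QF D \<Longrightarrow> y \<in> QF D \<Longrightarrow> x / y \<in> QF D"
  unfolding divide_inverse by (intro dom_mult dom_in_QF QF_inverse)

lemma submod_QF: "dom_in D \<Longrightarrow> submod D (QF D)"
  using sub_QF by (intro submodI) (auto intro: dom_in_mem dom_in_QF)

lemma span_inI:
  assumes "finite F" "F \<subseteq> S" "\<And>s. s \<in> F \<Longrightarrow> c s \<in> D"
  shows "(\<Sum>s\<in>F. c s * s) \<in> span_in D S"
  using assms by (auto simp: span_in_def)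

lemma span_superset: "dom_in D \<Longrightarrow> S \<subseteq> span_in D S"
  using span_inI[of "{s}" S "\<lambda>_. 1" D for s] by (auto intro: dom_one)

lemma submod_span:
  assumes D: "dom_in D"
  shows "submod D (span_in D S)"
proof (rule submodI)
  show "0 \<in> span_in D S" using span_inI[of "{}" S] by auto
next
  fix a b assume "a \<in> span_in D S" "b \<in> span_in D S"
  then obtain F c G d where e: "finite F" "F \<subseteq> S" "\<forall>s\<in>F. c s \<in> D" "a = (\<Sum>s\<in>F. c s * s)"
    "finite G" "G \<subseteq> S" "\<forall>s\<in>G. d s \<in> D" "b = (\<Sum>s\<in>G. d s * s)"
    by (auto simp: span_in_def)
  let ?c = "\<lambda>s. if s \<in> F then c s else 0" and ?d = "\<lambda>s. if s \<in> G then d s else 0"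
  have "a = (\<Sum>s\<in>F \<union> G. ?c s * s)" "b = (\<Sum>s\<in>F \<union> G. ?d s * s)"
    unfolding e by (intro sum.mono_neutral_cong_left; use e in auto)+
  then have "a + b = (\<Sum>s\<in>F \<union> G. (?c s + ?d s) * s)"
    by (simp only: sum.distrib[symmetric] distrib_right)
  also have "\<dots> \<in> span_in D S"
    by (rule span_inI) (use e in \<open>auto intro: dom_in_mem[OF D]\<close>)
  finally show "a + b \<in> span_in D S" .
next
  fix r a assume r: "r \<in> D" and "a \<in> span_in D S"
  then obtain F c where e: "finite F" "F \<subseteq> S" "\<forall>s\<in>F. c s \<in> D" "a = (\<Sum>s\<in>F. c s * s)"
    by (auto simp: span_in_def)
  have "r * a = (\<Sum>s\<in>F. (r * c s) * s)" unfolding e by (simp add: sum_distrib_left mult.assoc)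
  also have "\<dots> \<in> span_in D S" by (rule span_inI) (use e r in \<open>auto intro: dom_in_mem[OF D]\<close>)
  finally show "r * a \<in> span_in D S" .
qed

lemma span_least:
  assumes "submod D I" "S \<subseteq> I"
  shows "span_in D S \<subseteq> I"
  using assms by (auto simp: span_in_def intro!: submod_sum[OF assms(1)] intro: submod_mult[OF assms(1)])

lemma submod_prod: "dom_in D \<Longrightarrow> submod D (prod_in D A B)"
  unfolding prod_in_def by (rule submod_span)

lemma prod_mem: "dom_in D \<Longrightarrow> a \<in> A \<Longrightarrow> b \<in> B \<Longrightarrow> a * b \<in> prod_in D A B"
  unfolding prod_in_def by (rule subsetD[OF span_superset]) auto

lemma prod_least:
  assumes "submod D I" "\<And>a b. a \<in> A \<Longrightarrow> b \<in> B \<Longrightarrow> a * b \<in> I"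
  shows "prod_in D A B \<subseteq> I"
  unfolding prod_in_def using assms by (intro span_least) auto

lemma colonI: "x \<in> QF D \<Longrightarrow> (\<And>b. b \<in> B \<Longrightarrow> x * b \<in> A) \<Longrightarrow> x \<in> colon D A B"
  by (auto simp: colon_def)

lemma colonD: "x \<in> colon D A B \<Longrightarrow> b \<in> B \<Longrightarrow> x * b \<in> A" "x \<in> colon D A B \<Longrightarrow> x \<in> QF D"
  by (auto simp: colon_def)

lemma submod_colon:
  assumes "dom_in D" "submod D A"
  shows "submod D (colon D A B)"
  using submod_QF[OF assms(1)] assms(2)
  by (intro submodI colonI)
     (auto simp: colon_def distrib_right mult.assoc dest: submod_mem)

lemma colon_span:
  assumes D: "dom_in D" and A: "submod D A"
  shows "colon D A (span_in D S) = colon D A S"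
proof
  show "colon D A (span_in D S) \<subseteq> colon D A S"
    using span_superset[OF D] by (fastforce simp: colon_def)
  show "colon D A S \<subseteq> colon D A (span_in D S)"
  proof
    fix x assume x: "x \<in> colon D A S"
    have "submod D {b. x * b \<in> A}"
      by (rule submodI) (auto simp: distrib_left mult.left_commute intro: submod_mem[OF A])
    then have "span_in D S \<subseteq> {b. x * b \<in> A}"
      by (rule span_least) (use x in \<open>auto dest: colonD\<close>)
    then show "x \<in> colon D A (span_in D S)" using x by (auto simp: colon_def)
  qed
qed

section \<open>Divisorial closure and t-closure\<close>

lemma v_op_iff: "x \<in> v_op D S \<longleftrightarrow> x \<in> QF D \<and> (\<forall>y\<in>QF D. (\<forall>s\<in>S. y * s \<in> D) \<longrightarrow> x * y \<in> D)"
  by (auto simp: v_op_def colon_def)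

text \<open>Multipliers into a submodule need testing on generators only. Finite sets can therefore
  stand in for finitely generated submodules in what follows.\<close>

lemma v_op_span: "dom_in D \<Longrightarrow> v_op D (span_in D S) = v_op D S"
  by (simp add: v_op_def colon_span submod_self)

lemma v_op_mono: "S \<subseteq> S' \<Longrightarrow> v_op D S \<subseteq> v_op D S'"
  by (rule subsetI) (unfold v_op_iff, blast)

lemma v_op_superset: "S \<subseteq> QF D \<Longrightarrow> S \<subseteq> v_op D S"
  unfolding subset_eq v_op_iff by (metis mult.commute)

text \<open>Idempotence and monotonicity in one rule: a multiplier of S' into D carries all of
  \<open>v_op D S'\<close> into D, in particular S.\<close>

lemma v_op_least:
  assumes "S \<subseteq> v_op D S'"
  shows "v_op D S \<subseteq> v_op D S'"
proof
  fix x assume x: "x \<in> v_op D S"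
  have "x * y \<in> D" if y: "y \<in> QF D" "\<forall>s\<in>S'. y * s \<in> D" for y
  proof -
    have "\<forall>s\<in>S. s * y \<in> D" using assms y unfolding subset_eq v_op_iff by blast
    then have "\<forall>s\<in>S. y * s \<in> D" by (simp add: mult.commute)
    then show ?thesis using x y unfolding v_op_iff by blast
  qed
  then show "x \<in> v_op D S'" using x unfolding v_op_iff by blast
qed

lemma submod_v_op: "dom_in D \<Longrightarrow> submod D (v_op D S)"
  unfolding v_op_def by (intro submod_colon submod_self)

text \<open>If y carries bS into D, then y b carries S into D. No division by b occurs, so b = 0 is
  allowed.\<close>

lemma v_op_scale:
  assumes "dom_in D" "b \<in> QF D" "x \<in> v_op D S"
  shows "b * x \<in> v_op D ((*) b ` S)"
proof -
  have "b * x * y \<in> D" if "y \<in> QF D" "\<forall>s\<in>S. y * (b * s) \<in> D" for y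
  proof -
    have "y * b \<in> QF D" using assms that by (auto intro: dom_mult dom_in_QF)
    then have "x * (y * b) \<in> D" using assms(3) that by (auto simp: v_op_iff mult.assoc)
    then show ?thesis by (simp add: algebra_simps)
  qed
  then show ?thesis using assms by (auto simp: v_op_iff intro: dom_mult dom_in_QF)
qed

lemma v_op_sub:
  assumes "dom_in D" "S \<subseteq> D"
  shows "v_op D S \<subseteq> D"
proof
  fix x assume "x \<in> v_op D S"
  moreover have "1 \<in> QF D" using sub_QF dom_one assms(1) by blast
  ultimately have "(\<forall>s\<in>S. 1 * s \<in> D) \<longrightarrow> x * 1 \<in> D" unfolding v_op_iff by blast
  then show "x \<in> D" using assms(2) by auto
qed

text \<open>Adjoining a nonzero element of \<^term>\<open>I\<close> to \<^term>\<open>S\<close> shows that the nonzero requirement on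
  the finitely generated submodules is harmless.\<close>

lemma t_op_iff:
  assumes D: "dom_in D" and I: "submod D I" "I \<subseteq> QF D" "I \<noteq> {0}"
  shows "x \<in> t_op D I \<longleftrightarrow> (\<exists>S. finite S \<and> S \<subseteq> I \<and> x \<in> v_op D S)"
proof
  assume "x \<in> t_op D I"
  then obtain S where "finite S" "span_in D S \<subseteq> I" "x \<in> v_op D (span_in D S)"
    by (auto simp: t_op_def fg_nonzero_def)
  then show "\<exists>S. finite S \<and> S \<subseteq> I \<and> x \<in> v_op D S"
    using span_superset[OF D, of S] v_op_span[OF D, of S] by blast
next
  assume "\<exists>S. finite S \<and> S \<subseteq> I \<and> x \<in> v_op D S"
  then obtain S where S: "finite S" "S \<subseteq> I" "x \<in> v_op D S" by blast
  obtain a where a: "a \<in> I" "a \<noteq> 0" using I submod_zero[OF I(1)] by blast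
  let ?J = "span_in D (insert a S)"
  have "?J \<subseteq> I" using S a by (intro span_least I) auto
  moreover have "a \<in> ?J" using span_superset[OF D] by blast
  moreover have "x \<in> v_op D ?J" using S v_op_mono[of S "insert a S" D] by (auto simp: v_op_span[OF D])
  moreover have "fg_nonzero D ?J" unfolding fg_nonzero_def
    using S a I(2) \<open>a \<in> ?J\<close> by (intro conjI exI[of _ "insert a S"]) auto
  ultimately show "x \<in> t_op D I" unfolding t_op_def by blast
qed

lemma t_op_mono: "I \<subseteq> I' \<Longrightarrow> t_op D I \<subseteq> t_op D I'"
  by (auto simp: t_op_def)

lemma t_ideal_v_op:
  assumes "t_ideal D I" "dom_in D" "finite S" "S \<subseteq> I"
  shows "v_op D S \<subseteq> I"
proof -
  have "submod D I" "I \<subseteq> QF D" "I \<noteq> {0}" "t_op D I = I"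
    using assms sub_QF[of D] by (auto simp: t_ideal_def is_ideal_iff)
  then show ?thesis using t_op_iff[OF assms(2), of I] assms by blast
qed

lemma t_op_superset:
  assumes "dom_in D" "submod D I" "I \<subseteq> QF D" "I \<noteq> {0}"
  shows "I \<subseteq> t_op D I"
proof
  fix x assume "x \<in> I"
  then have "x \<in> v_op D {x}" using v_op_superset[of "{x}" D] assms by auto
  then show "x \<in> t_op D I" using t_op_iff[OF assms] \<open>x \<in> I\<close> by blast
qed

lemma t_ideal_iff:
  assumes D: "dom_in D"
  shows "t_ideal D I \<longleftrightarrow> is_ideal D I \<and> I \<noteq> {0} \<and> (\<forall>S. finite S \<and> S \<subseteq> I \<longrightarrow> v_op D S \<subseteq> I)"
proof
  assume "t_ideal D I"
  then show "is_ideal D I \<and> I \<noteq> {0} \<and> (\<forall>S. finite S \<and> S \<subseteq> I \<longrightarrow> v_op D S \<subseteq> I)"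
    using t_ideal_v_op[of D I, OF _ D] by (simp add: t_ideal_def)
next
  assume I: "is_ideal D I \<and> I \<noteq> {0} \<and> (\<forall>S. finite S \<and> S \<subseteq> I \<longrightarrow> v_op D S \<subseteq> I)"
  then have *: "submod D I" "I \<subseteq> QF D" "I \<noteq> {0}" using sub_QF[OF D] by (auto simp: is_ideal_iff)
  have "t_op D I \<subseteq> I"
  proof
    fix x assume "x \<in> t_op D I"
    then obtain S where "finite S" "S \<subseteq> I" "x \<in> v_op D S" using t_op_iff[OF D *, of x] by blast
    then show "x \<in> I" using I by blast
  qed
  then show "t_ideal D I" using t_op_superset[OF D *] I by (auto simp: t_ideal_def)
qed

text \<open>Finitely many elements of the t-closure lie in the v-closures of finitely many finite
  sets, and the union F of these sets serves them all. Then \<open>v_op_least\<close> keeps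
  \<open>v_op D S\<close> inside \<open>v_op D F\<close>.\<close>

lemma t_ideal_t_op:
  assumes D: "dom_in D" and I: "is_ideal D I" "I \<noteq> {0}"
  shows "t_ideal D (t_op D I)"
proof -
  have I': "submod D I" "I \<subseteq> QF D" "I \<noteq> {0}" using sub_QF[OF D] I by (auto simp: is_ideal_iff)
  note iff = t_op_iff[OF D I']
  have "submod D (t_op D I)"
  proof (rule submodI)
    show "0 \<in> t_op D I" using t_op_superset[OF D I'] submod_zero[OF I'(1)] by blast
  next
    fix a b assume "a \<in> t_op D I" "b \<in> t_op D I"
    then obtain S S' where "finite S" "S \<subseteq> I" "a \<in> v_op D S" "finite S'" "S' \<subseteq> I" "b \<in> v_op D S'"
      by (auto simp: iff)
    moreover from this have "a + b \<in> v_op D (S \<union> S')"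
      using v_op_mono[of S "S \<union> S'" D] v_op_mono[of S' "S \<union> S'" D]
      by (intro submod_add[OF submod_v_op[OF D]]) auto
    ultimately show "a + b \<in> t_op D I" unfolding iff by (intro exI[of _ "S \<union> S'"]) auto
  next
    fix r a assume "r \<in> D" "a \<in> t_op D I"
    then show "r * a \<in> t_op D I" unfolding iff using submod_mult[OF submod_v_op[OF D]] by blast
  qed
  moreover have "t_op D I \<subseteq> D"
  proof
    fix x assume "x \<in> t_op D I"
    then obtain S where "S \<subseteq> I" "x \<in> v_op D S" unfolding iff by blast
    then show "x \<in> D" using v_op_sub[OF D, of S] I by (auto simp: is_ideal_iff)
  qed
  moreover have "t_op D I \<noteq> {0}" using t_op_superset[OF D I'] I submod_zero[OF I'(1)] by blast
  moreover have "v_op D S \<subseteq> t_op D I" if S: "finite S" "S \<subseteq> t_op D I" for S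
  proof -
    have "\<exists>F. finite F \<and> F \<subseteq> I \<and> S \<subseteq> v_op D F" using S
    proof (induction S)
      case (insert x S)
      then obtain F where "finite F" "F \<subseteq> I" "S \<subseteq> v_op D F" by auto
      moreover obtain G where "finite G" "G \<subseteq> I" "x \<in> v_op D G" using insert.prems iff[of x] by blast
      ultimately show ?case
        using v_op_mono[of F "F \<union> G" D] v_op_mono[of G "F \<union> G" D] by (intro exI[of _ "F \<union> G"]) auto
    qed auto
    then obtain F where "finite F" "F \<subseteq> I" "S \<subseteq> v_op D F" by blast
    then have "x \<in> t_op D I" if "x \<in> v_op D F" for x using that unfolding iff by blast
    then show ?thesis using v_op_least[OF \<open>S \<subseteq> v_op D F\<close>] by blast
  qed
  ultimately show ?thesis unfolding t_ideal_iff[OF D] is_ideal_iff by blast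
qed

section \<open>Maximal t-ideals\<close>

text \<open>A field has no proper nonzero ideal, hence no maximal t-ideal. Excluding it makes
  \<open>t_Max R\<close> nonempty, on which the descriptions of \<open>N_t\<close> and of the
  maximal ideals of T depend.\<close>

locale proper_domain =
  fixes R :: "'a::field set"
  assumes dom: "dom_in R" and proper: "QF R \<noteq> R"
begin

lemma t_MaxD:
  assumes "M \<in> t_Max R"
  shows "t_ideal R M" "submod R M" "M \<subseteq> R" "1 \<notin> M" "0 \<in> M"
proof -
  show M: "t_ideal R M" using assms unfolding t_Max_def by blast
  then show "submod R M" "M \<subseteq> R" by (simp_all add: t_ideal_def is_ideal_iff)
  then show "0 \<in> M" using submod_zero by blast
  have "M \<noteq> R" using assms unfolding t_Max_def by blast
  then show "1 \<notin> M" using ideal_eq_whole[of R M] M unfolding t_ideal_def by blast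
qed

text \<open>Zorn's lemma applies because being t-closed is a condition on finite subsets: a finite
  subset of the union of a chain lies in one member, so the union is again a t-ideal. It stays
  proper because 1 lies in no member.\<close>

lemma t_Max_exists:
  assumes I: "t_ideal R I" "I \<noteq> R"
  obtains M where "M \<in> t_Max R" "I \<subseteq> M"
proof -
  define A where "A = {J. t_ideal R J \<and> J \<noteq> R \<and> I \<subseteq> J}"
  have "\<exists>M\<in>A. \<forall>X\<in>A. M \<subseteq> X \<longrightarrow> X = M"
  proof (rule subset_Zorn_nonempty)
    show "A \<noteq> {}" using I by (auto simp: A_def)
    fix C assume C: "C \<noteq> {}" "subset.chain A C"
    have CA: "t_ideal R J" "1 \<notin> J" "I \<subseteq> J" if "J \<in> C" for J
    proof -
      have "J \<in> A" using C(2) that unfolding subset.chain_def by blast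
      then show J: "t_ideal R J" "I \<subseteq> J" unfolding A_def by blast+
      then show "1 \<notin> J" using ideal_eq_whole[of R J] \<open>J \<in> A\<close> unfolding A_def t_ideal_def by blast
    qed
    have sub: "submod R J" "J \<subseteq> R" if "J \<in> C" for J
      using CA[OF that] by (auto simp: t_ideal_def is_ideal_iff)
    have fin: "\<exists>J\<in>C. S \<subseteq> J" if "finite S" "S \<subseteq> \<Union>C" for S
      using finite_subset_Union_chain[OF that C] by blast
    have "submod R (\<Union>C)"
    proof (rule submodI)
      fix a b assume "a \<in> \<Union>C" "b \<in> \<Union>C"
      then obtain J where J: "J \<in> C" "{a, b} \<subseteq> J" using fin[of "{a, b}"] by auto
      then have "a + b \<in> J" using submod_add[OF sub(1)[OF J(1)], of a b] by simp
      then show "a + b \<in> \<Union>C" using J by blast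
    next
      obtain J where J: "J \<in> C" using C(1) by blast
      then show "0 \<in> \<Union>C" using submod_zero[OF sub(1)[OF J]] by blast
    next
      fix r a assume r: "r \<in> R" and "a \<in> \<Union>C"
      then obtain J where J: "J \<in> C" "a \<in> J" by blast
      then show "r * a \<in> \<Union>C" using submod_mult[OF sub(1)[OF J(1)] r] by blast
    qed
    moreover have "\<Union>C \<subseteq> R" using sub by blast
    moreover have "v_op R S \<subseteq> \<Union>C" if S: "finite S" "S \<subseteq> \<Union>C" for S
    proof -
      obtain J where "J \<in> C" "S \<subseteq> J" using fin[OF S] by blast
      then show ?thesis using t_ideal_v_op[OF CA(1) dom, of J S] S by blast
    qed
    moreover have IC: "I \<subseteq> \<Union>C" using C(1) CA(3) by blast
    moreover have "I \<noteq> {0}" "0 \<in> I" using I(1) by (simp_all add: t_ideal_def is_ideal_def)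
    then have "\<Union>C \<noteq> {0}" using IC by (metis empty_iff subset_singletonD)
    ultimately have "t_ideal R (\<Union>C)" unfolding t_ideal_iff[OF dom] is_ideal_iff by simp
    moreover have "\<Union>C \<noteq> R" using CA(2) dom_one[OF dom] by blast
    ultimately show "\<Union>C \<in> A" using IC unfolding A_def by simp
  qed
  then obtain M where M: "M \<in> A" "\<And>X. X \<in> A \<Longrightarrow> M \<subseteq> X \<Longrightarrow> X = M" by blast
  then have "I \<subseteq> M" "t_ideal R M" "M \<noteq> R" unfolding A_def by blast+
  moreover have "J = M" if "t_ideal R J" "J \<noteq> R" "M \<subseteq> J" for J
    using M(2)[of J] that \<open>I \<subseteq> M\<close> unfolding A_def by blast
  ultimately show ?thesis using that[of M] unfolding t_Max_def by blast
qed

text \<open>If \<open>a / b\<close> is outside R, then b is a nonzero nonunit and bR is a proper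
  t-ideal; it is even divisorial, since the multiplier \<open>inverse b\<close> carries it into
  R.\<close>

lemma t_Max_nonempty: "t_Max R \<noteq> {}"
proof -
  obtain a b where ab: "a \<in> R" "b \<in> R" "b \<noteq> 0" "a / b \<notin> R"
    using proper sub_QF[OF dom] by (auto simp: QF_def)
  let ?I = "(*) b ` R"
  have inv: "inverse b \<in> QF R" using QF_inverse[OF dom] sub_QF[OF dom] ab by auto
  have 1: "submod R ?I"
  proof (rule submodI)
    show "0 \<in> ?I" using dom_zero[OF dom] by (force simp: image_iff)
    fix x y assume "x \<in> ?I" "y \<in> ?I"
    then obtain c d where "x = b * c" "c \<in> R" "y = b * d" "d \<in> R" by blast
    then show "x + y \<in> ?I"
      by (intro image_eqI[of _ _ "c + d"]) (auto simp: distrib_left intro: dom_add[OF dom])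
  next
    fix r x assume "r \<in> R" "x \<in> ?I"
    then obtain c where "x = b * c" "c \<in> R" by blast
    then show "r * x \<in> ?I" using \<open>r \<in> R\<close>
      by (intro image_eqI[of _ _ "r * c"]) (auto intro: dom_mult[OF dom])
  qed
  have 2: "?I \<subseteq> R" using ab by (auto intro: dom_mult[OF dom])
  have "b \<in> ?I" using dom_one[OF dom] by (force simp: image_iff)
  then have 3: "?I \<noteq> {0}" using ab(3) by blast
  have 4: "v_op R S \<subseteq> ?I" if "S \<subseteq> ?I" for S
  proof
    fix x assume x: "x \<in> v_op R S"
    have "inverse b * s \<in> R" if "s \<in> S" for s
    proof -
      obtain c where "s = b * c" "c \<in> R" using \<open>S \<subseteq> ?I\<close> \<open>s \<in> S\<close> by blast
      then show ?thesis using ab(3) by (simp add: mult.assoc[symmetric])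
    qed
    then have "x * inverse b \<in> R" using x inv by (auto simp: v_op_iff)
    then show "x \<in> ?I" using ab by (auto simp: image_iff intro!: bexI[of _ "x * inverse b"])
  qed
  have 5: "?I \<noteq> R"
  proof
    assume "?I = R"
    then obtain c where "a = b * c" "c \<in> R" using ab by auto
    then show False using ab by simp
  qed
  have "t_ideal R ?I" unfolding t_ideal_iff[OF dom] is_ideal_iff
    by (intro conjI allI impI 1 2 3 4) (elim conjE)
  from t_Max_exists[OF this 5] obtain M where "M \<in> t_Max R" "?I \<subseteq> M" .
  then show ?thesis by blast
qed

text \<open>A proper t-closure of I would lie in a maximal t-ideal, so the t-closure is R and a
  finite S witnesses that it contains 1. Local-to-global arguments go through this witness.\<close>

lemma ideal_v_one:
  assumes I: "is_ideal R I" and M: "\<And>M. M \<in> t_Max R \<Longrightarrow> \<not> I \<subseteq> M"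
  obtains S where "finite S" "S \<subseteq> I" "1 \<in> v_op R S"
proof -
  have ne: "I \<noteq> {0}"
  proof
    assume "I = {0}"
    moreover obtain N where "N \<in> t_Max R" using t_Max_nonempty by blast
    ultimately show False using M[of N] t_MaxD(5)[of N] by simp
  qed
  have I': "submod R I" "I \<subseteq> QF R" using I sub_QF[OF dom] by (auto simp: is_ideal_iff)
  have "t_op R I = R"
  proof (rule ccontr)
    assume "t_op R I \<noteq> R"
    from t_Max_exists[OF t_ideal_t_op[OF dom I ne] this]
    obtain M' where "M' \<in> t_Max R" "t_op R I \<subseteq> M'" .
    then show False using M[of M'] t_op_superset[OF dom I' ne] by blast
  qed
  then have "\<exists>S. finite S \<and> S \<subseteq> I \<and> 1 \<in> v_op R S"
    using t_op_iff[OF dom I' ne, of 1] dom_one[OF dom] by simp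
  then show ?thesis using that by blast
qed

text \<open>Scaling \<open>1 \<in> v_op R S\<close> by x puts x into the v-closure of the finite set
  xS, which stays inside I.\<close>

lemma t_ideal_v_one:
  assumes "t_ideal R I" "x \<in> QF R" "finite S" "1 \<in> v_op R S" "\<And>s. s \<in> S \<Longrightarrow> x * s \<in> I"
  shows "x \<in> I"
proof -
  have "x \<in> v_op R ((*) x ` S)" using v_op_scale[OF dom assms(2,4)] by simp
  moreover have "v_op R ((*) x ` S) \<subseteq> I"
    using assms by (intro t_ideal_v_op dom) auto
  ultimately show ?thesis by blast
qed

text \<open>For a outside M the ideal M + Ra lies in no maximal t-ideal, so it contains a finite S
  with 1 in its v-closure. As a b is in M, the element b carries S into M, hence b is in M.\<close>

lemma t_Max_prime:
  assumes M: "M \<in> t_Max R"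
  shows "prime_ideal R M"
proof -
  note D = t_MaxD[OF M]
  have "b \<in> M" if ab: "a \<in> R" "b \<in> R" "a * b \<in> M" "a \<notin> M" for a b
  proof -
    let ?I = "{m + r * a | m r. m \<in> M \<and> r \<in> R}"
    have I: "is_ideal R ?I" unfolding is_ideal_iff
    proof (intro conjI submodI)
      show "?I \<subseteq> R" using D ab by (auto intro!: dom_in_mem[OF dom])
      show "0 \<in> ?I" using D dom_zero[OF dom] by force
    next
      fix x y assume "x \<in> ?I" "y \<in> ?I"
      then obtain m r n s where e: "m \<in> M" "r \<in> R" "x = m + r * a" "n \<in> M" "s \<in> R" "y = n + s * a" by auto
      then have "x + y = (m + n) + (r + s) * a" by (simp add: algebra_simps)
      then show "x + y \<in> ?I" using e submod_add[OF D(2)] dom_add[OF dom] by blast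
    next
      fix t x assume t: "t \<in> R" "x \<in> ?I"
      then obtain m r where e: "m \<in> M" "r \<in> R" "x = m + r * a" by auto
      then have "t * x = t * m + (t * r) * a" by (simp add: algebra_simps)
      then show "t * x \<in> ?I" using e t submod_mult[OF D(2)] dom_mult[OF dom] by blast
    qed
    have MI: "M \<subseteq> ?I" using dom_zero[OF dom] by force
    have aI: "a \<in> ?I" using D(5) dom_one[OF dom] by force
    have "\<not> ?I \<subseteq> N" if N: "N \<in> t_Max R" for N
    proof
      assume "?I \<subseteq> N"
      then have "M \<subseteq> N" "a \<in> N" using MI aI by blast+
      then have "N = M" using M N unfolding t_Max_def by blast
      then show False using \<open>a \<in> N\<close> ab by simp
    qed
    from ideal_v_one[OF I this] obtain S where S: "finite S" "S \<subseteq> ?I" "1 \<in> v_op R S" .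
    show "b \<in> M"
    proof (rule t_ideal_v_one[OF D(1) _ S(1,3)])
      show "b \<in> QF R" using sub_QF[OF dom] ab by blast
      fix s assume "s \<in> S"
      then obtain m r where e: "m \<in> M" "r \<in> R" "s = m + r * a" using S(2) by blast
      then have "b * s = b * m + r * (a * b)" by (simp add: algebra_simps)
      then show "b * s \<in> M" using e ab by (simp add: submod_add[OF D(2)] submod_mult[OF D(2)])
    qed
  qed
  then show ?thesis using D dom_one[OF dom] by (auto simp: prime_ideal_def is_ideal_iff)
qed

text \<open>Since M contains 0, elements outside M are invertible in the field, and membership in a
  localization becomes the existence of a multiplier outside M.\<close>

lemma w_op_iff: "x \<in> w_op R I \<longleftrightarrow> x \<in> QF R \<and> (\<forall>M\<in>t_Max R. \<exists>u\<in>R - M. u * x \<in> I)"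
proof -
  have "x \<in> loc_mod R M I \<longleftrightarrow> (\<exists>u\<in>R - M. u * x \<in> I)" if "M \<in> t_Max R" for M
  proof
    assume "x \<in> loc_mod R M I"
    then obtain e s where "x = e / s" "e \<in> I" "s \<in> R" "s \<notin> M" by (auto simp: loc_mod_def)
    moreover have "s \<noteq> 0" using t_MaxD(5)[OF that] calculation by auto
    ultimately show "\<exists>u\<in>R - M. u * x \<in> I" by (intro bexI[of _ s]) auto
  next
    assume "\<exists>u\<in>R - M. u * x \<in> I"
    then obtain u where u: "u \<in> R" "u \<notin> M" "u * x \<in> I" by blast
    then have "u \<noteq> 0" using t_MaxD(5)[OF that] by auto
    then have "x = (u * x) / u" by simp
    then show "x \<in> loc_mod R M I" using u unfolding loc_mod_def by blast
  qed
  then show ?thesis by (auto simp: w_op_def)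
qed

lemma w_op_superset: "I \<subseteq> QF R \<Longrightarrow> I \<subseteq> w_op R I"
  unfolding w_op_iff subset_eq using dom_one[OF dom] t_MaxD(4) by (metis Diff_iff mult_1)

text \<open>The elements carrying \<^term>\<open>x\<close> into \<^term>\<open>I\<close> form an ideal that lies in no maximal t-ideal.\<close>

lemma w_op_v_one:
  assumes I: "submod R I" and x: "x \<in> w_op R I"
  obtains S where "finite S" "S \<subseteq> R" "1 \<in> v_op R S" "\<And>s. s \<in> S \<Longrightarrow> x * s \<in> I"
proof -
  let ?J = "{r \<in> R. x * r \<in> I}"
  have J: "is_ideal R ?J" unfolding is_ideal_iff
  proof (intro conjI submodI)
    fix r a assume "r \<in> R" "a \<in> ?J"
    then show "r * a \<in> ?J"
      using submod_mult[OF I, of r "x * a"] by (auto simp: mult.left_commute intro: dom_mult[OF dom])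
  qed (auto simp: distrib_left intro: dom_in_mem[OF dom] submod_zero[OF I] submod_add[OF I])
  have "\<not> ?J \<subseteq> M" if M: "M \<in> t_Max R" for M
  proof -
    obtain u where "u \<in> R - M" "u * x \<in> I" using x M unfolding w_op_iff by blast
    then show ?thesis by (auto simp: mult.commute)
  qed
  from ideal_v_one[OF J this] obtain S where S: "finite S" "S \<subseteq> ?J" "1 \<in> v_op R S" .
  show ?thesis by (rule that[of S]) (use S in auto)
qed

text \<open>In effect the w-closure lies below the t-closure: a finite S with 1 in its v-closure and
  xS inside I forces x into I.\<close>

lemma t_ideal_w_ideal:
  assumes "t_ideal R I"
  shows "w_ideal R I"
proof -
  have I: "is_ideal R I" "I \<noteq> {0}" using assms by (auto simp: t_ideal_def)
  have "x \<in> I" if x: "x \<in> w_op R I" for x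
  proof -
    have "submod R I" using I by (simp add: is_ideal_iff)
    from w_op_v_one[OF this x]
    obtain S where S: "finite S" "S \<subseteq> R" "1 \<in> v_op R S" "\<And>s. s \<in> S \<Longrightarrow> x * s \<in> I" by blast
    have "x \<in> QF R" using x unfolding w_op_iff by blast
    from t_ideal_v_one[OF assms this S(1,3,4)] show "x \<in> I" .
  qed
  then show ?thesis using I w_op_superset[of I] sub_QF[OF dom] unfolding w_ideal_def is_ideal_iff by blast
qed

lemma t_ideal_R: "t_ideal R R"
  unfolding t_ideal_iff[OF dom] is_ideal_iff
  using v_op_sub[OF dom] dom_one[OF dom] submod_self[OF dom] by (intro conjI) auto

lemma w_op_R: "w_op R R = R"
  using t_ideal_w_ideal[OF t_ideal_R] by (simp add: w_ideal_def)

end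

section \<open>Polynomials with coefficients in a submodule\<close>

lemma poly_over_mono: "I \<subseteq> I' \<Longrightarrow> poly_over I f \<Longrightarrow> poly_over I' f"
  by (auto simp: poly_over_def)

lemma poly_over_0: "submod D I \<Longrightarrow> poly_over I 0"
  by (simp add: poly_over_def submod_zero)

lemma poly_over_add: "submod D I \<Longrightarrow> poly_over I f \<Longrightarrow> poly_over I g \<Longrightarrow> poly_over I (f + g)"
  by (simp add: poly_over_def submod_add)

lemma poly_over_mult:
  assumes "submod D I" "poly_over D g" "poly_over I f"
  shows "poly_over I (g * f)"
  unfolding poly_over_def coeff_mult
  using assms by (intro allI submod_sum[OF assms(1)]) (auto simp: poly_over_def intro: submod_mult)

lemma poly_over_const: "submod D I \<Longrightarrow> a \<in> I \<Longrightarrow> poly_over I [:a:]"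
  by (auto simp: poly_over_def coeff_pCons submod_zero split: nat.splits)

lemma poly_over_monom: "dom_in D \<Longrightarrow> poly_over D (monom 1 n)"
  by (simp add: poly_over_def dom_one dom_zero)

lemma poly_over_smult: "(\<And>b. b \<in> I \<Longrightarrow> a * b \<in> I') \<Longrightarrow> poly_over I f \<Longrightarrow> poly_over I' (smult a f)"
  by (simp add: poly_over_def)

text \<open>Gauss's lemma for prime ideals. With i and j the first indices at which f and g leave P,
  the coefficient of f g at i + j is congruent to \<open>coeff f i * coeff g j\<close> modulo
  P.\<close>

lemma poly_over_prime:
  assumes P: "prime_ideal D P" and D: "dom_in D"
    and f: "poly_over D f" and g: "poly_over D g" and fg: "poly_over P (f * g)"
  shows "poly_over P f \<or> poly_over P g"
proof (rule ccontr)
  assume neg: "\<not> (poly_over P f \<or> poly_over P g)"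
  define i where "i = (LEAST i. coeff f i \<notin> P)"
  define j where "j = (LEAST j. coeff g j \<notin> P)"
  have ex: "\<exists>i. coeff f i \<notin> P" "\<exists>j. coeff g j \<notin> P" using neg by (auto simp: poly_over_def)
  have i: "coeff f i \<notin> P" and j: "coeff g j \<notin> P"
    unfolding i_def j_def by (rule LeastI_ex[OF ex(1)], rule LeastI_ex[OF ex(2)])
  have i': "coeff f k \<in> P" if "k < i" for k using that not_less_Least unfolding i_def by blast
  have j': "coeff g k \<in> P" if "k < j" for k using that not_less_Least unfolding j_def by blast
  have sP: "submod D P" using P by (simp add: prime_ideal_def is_ideal_iff)
  let ?r = "\<Sum>k\<in>{..i + j} - {i}. coeff f k * coeff g (i + j - k)"
  have "?r \<in> P"
  proof (rule submod_sum[OF sP])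
    fix k assume k: "k \<in> {..i + j} - {i}"
    show "coeff f k * coeff g (i + j - k) \<in> P"
    proof (cases "k < i")
      case True
      then have "coeff g (i + j - k) * coeff f k \<in> P"
        using g i' submod_mult[OF sP] by (simp add: poly_over_def)
      then show ?thesis by (simp add: mult.commute)
    next
      case False
      then have "i + j - k < j" using k by auto
      then show ?thesis using f j' submod_mult[OF sP] by (simp add: poly_over_def)
    qed
  qed
  then have "- 1 * ?r \<in> P" using submod_mult[OF sP] dom_uminus[OF D dom_one[OF D]] by blast
  moreover have "coeff (f * g) (i + j) = coeff f i * coeff g j + ?r"
    unfolding coeff_mult by (subst sum.remove[of _ i]) auto
  moreover have "coeff (f * g) (i + j) \<in> P" using fg by (simp add: poly_over_def)
  ultimately have "coeff f i * coeff g j \<in> P"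
    using submod_add[OF sP, of "coeff (f * g) (i + j)" "- 1 * ?r"] by simp
  then show False using i j f g P by (auto simp: prime_ideal_def poly_over_def)
qed

text \<open>Shifting g past the degree of f keeps the two coefficient sequences apart, so the
  content of the merged polynomial is the sum of the two contents. This replaces several polynomials
  by one, both to reach \<open>N_t\<close> and to obtain Bezout generators.\<close>

lemma coeff_merge:
  fixes f g :: "'a::comm_semiring_1 poly"
  shows "coeff (f + monom 1 (Suc (degree f)) * g) k =
     (if k \<le> degree f then coeff f k else coeff g (k - Suc (degree f)))"
  by (auto simp: coeff_monom_mult coeff_eq_0)

lemma range_coeff_merge:
  fixes f g :: "'a::comm_semiring_1 poly"
  shows "range (coeff f) \<subseteq> range (coeff (f + monom 1 (Suc (degree f)) * g))" (is "_ \<subseteq> range (coeff ?h)")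
    and "range (coeff g) \<subseteq> range (coeff (f + monom 1 (Suc (degree f)) * g))"
proof -
  show "range (coeff g) \<subseteq> range (coeff ?h)"
  proof
    fix a assume "a \<in> range (coeff g)"
    then obtain i where "a = coeff g i" by blast
    then have "a = coeff ?h (i + Suc (degree f))" unfolding coeff_merge by simp
    then show "a \<in> range (coeff ?h)" by blast
  qed
  \<comment> \<open>Beyond its degree f has coefficient 0, but in \<open>?h\<close> those positions
    belong to g; the value 0 is found among the coefficients of g.\<close>
  then have 0: "0 \<in> range (coeff ?h)" using range_coeff[of g] by blast
  show "range (coeff f) \<subseteq> range (coeff ?h)"
  proof
    fix a assume "a \<in> range (coeff f)"
    then obtain i where i: "a = coeff f i" by blast
    show "a \<in> range (coeff ?h)"
    proof (cases "i \<le> degree f")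
      case True
      then have "a = coeff ?h i" unfolding coeff_merge i by simp
      then show ?thesis by blast
    next
      case False
      then show ?thesis using 0 i by (simp add: coeff_eq_0)
    qed
  qed
qed

section \<open>The Nagata-type ring and extension of submodules\<close>

definition emb :: "'a::field \<Rightarrow> 'a poly fract" where
  "emb a = to_fract [:a:]"

lemma emb_simps [simp]:
  "emb 0 = 0" "emb 1 = 1" "emb (a + b) = emb a + emb b" "emb (a * b) = emb a * emb b"
  "emb (- a) = - emb a" "emb a = emb b \<longleftrightarrow> a = b" "emb a = 0 \<longleftrightarrow> a = 0"
proof -
  show "emb 0 = 0" "emb a = emb b \<longleftrightarrow> a = b" "emb a = 0 \<longleftrightarrow> a = 0" by (simp_all add: emb_def)
  show "emb 1 = 1" by (simp add: emb_def flip: one_pCons)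
  have "[:a + b:] = [:a:] + [:b:]" "[:a * b:] = [:a:] * [:b:]" "[:- a:] = - [:a:]" by simp_all
  then show "emb (a + b) = emb a + emb b" "emb (a * b) = emb a * emb b" "emb (- a) = - emb a"
    unfolding emb_def by (simp_all only: to_fract_add to_fract_mult to_fract_uminus)
qed

lemma emb_inverse [simp]: "emb (inverse a) = inverse (emb a)"
proof (cases "a = 0")
  case False
  then have "emb (inverse a) * emb a = 1" by (simp flip: emb_simps(4))
  then show ?thesis using False by (simp add: field_simps)
qed simp

lemma emb_divide [simp]: "emb (a / b) = emb a / emb b"
  by (simp add: divide_inverse)

lemma emb_power [simp]: "emb (a ^ n) = emb a ^ n"
  by (induction n) auto

lemma emb_sum: "emb (sum f A) = (\<Sum>x\<in>A. emb (f x))"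
  by (induction A rule: infinite_finite_induct) auto

lemma to_fract_smult: "to_fract (smult a f) = emb a * to_fract f"
  unfolding emb_def by (simp flip: to_fract_mult)

lemma to_fract_pCons: "to_fract (pCons a p) = emb a + to_fract (monom 1 1) * to_fract p"
proof -
  have "pCons a p = [:a:] + monom 1 1 * p" by (simp add: monom_Suc)
  then show ?thesis unfolding emb_def by (simp only: to_fract_add to_fract_mult)
qed

definition ext :: "'a::field set \<Rightarrow> 'a set \<Rightarrow> 'a poly fract set" where
  "ext R I = {Fract f g | f g. poly_over I f \<and> g \<in> N_t R}"

lemma RX_eq_ext: "RX R = ext R R"
  by (simp add: RX_def ext_def)

lemma extI: "poly_over I f \<Longrightarrow> g \<in> N_t R \<Longrightarrow> to_fract f / to_fract g \<in> ext R I"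
  unfolding ext_def Fract_conv_to_fract by blast

lemma extE:
  assumes "x \<in> ext R I"
  obtains f g where "poly_over I f" "g \<in> N_t R" "x = to_fract f / to_fract g"
  using assms unfolding ext_def Fract_conv_to_fract by blast

lemma ext_mono: "A \<subseteq> B \<Longrightarrow> ext R A \<subseteq> ext R B"
  unfolding ext_def using poly_over_mono by blast

context proper_domain
begin

lemma content_ideal:
  assumes "poly_over R f"
  shows "is_ideal R (content_ideal R f)" "range (coeff f) \<subseteq> content_ideal R f"
  using assms unfolding content_ideal_def is_ideal_iff
  by (auto intro!: submod_span[OF dom] subsetD[OF span_superset[OF dom]]
        dest!: subsetD[OF span_least[OF submod_self[OF dom]], rotated] simp: poly_over_def)

text \<open>A t-closure is proper exactly when some maximal t-ideal contains it. In the converse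
  direction the existence of a maximal t-ideal excludes f = 0, whose coefficients lie in every
  M.\<close>

lemma N_t_iff: "f \<in> N_t R \<longleftrightarrow> poly_over R f \<and> (\<forall>M\<in>t_Max R. \<not> poly_over M f)"
proof
  assume f: "f \<in> N_t R"
  then have f': "poly_over R f" and t: "t_op R (content_ideal R f) = R" by (auto simp: N_t_def)
  have "\<not> poly_over M f" if M: "M \<in> t_Max R" for M
  proof
    assume "poly_over M f"
    then have "range (coeff f) \<subseteq> M" by (auto simp: poly_over_def)
    then have "content_ideal R f \<subseteq> M" unfolding content_ideal_def
      by (rule span_least[OF t_MaxD(2)[OF M]])
    then have "R \<subseteq> t_op R M" using t_op_mono t by blast
    then have "R \<subseteq> M" using t_MaxD(1)[OF M] by (simp add: t_ideal_def)
    then show False using t_MaxD(4)[OF M] dom_one[OF dom] by blast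
  qed
  then show "poly_over R f \<and> (\<forall>M\<in>t_Max R. \<not> poly_over M f)" using f' by blast
next
  assume f: "poly_over R f \<and> (\<forall>M\<in>t_Max R. \<not> poly_over M f)"
  then have f': "poly_over R f" by blast
  note c = content_ideal[OF f']
  obtain N where N: "N \<in> t_Max R" using t_Max_nonempty by blast
  then have "\<not> poly_over N f" using f by blast
  then have nz: "f \<noteq> 0" using poly_over_0[OF t_MaxD(2)[OF N]] by auto
  then obtain i where i: "coeff f i \<noteq> 0" by (meson leading_coeff_0_iff)
  then have ne: "content_ideal R f \<noteq> {0}" using c(2) by blast
  have "\<not> content_ideal R f \<subseteq> M" if M: "M \<in> t_Max R" for M
    using f M c(2) unfolding poly_over_def by blast
  from ideal_v_one[OF c(1) this] obtain S where S: "finite S" "S \<subseteq> content_ideal R f" "1 \<in> v_op R S" .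
  have c': "submod R (content_ideal R f)" "content_ideal R f \<subseteq> QF R"
    using c(1) sub_QF[OF dom] by (auto simp: is_ideal_iff)
  have "1 \<in> t_op R (content_ideal R f)"
    using t_op_iff[OF dom c' ne, of 1] S by blast
  moreover have "is_ideal R (t_op R (content_ideal R f))"
    using t_ideal_t_op[OF dom c(1) ne] by (simp add: t_ideal_def)
  ultimately have "t_op R (content_ideal R f) = R" by (intro ideal_eq_whole)
  then show "f \<in> N_t R" using f' nz by (simp add: N_t_def)
qed

lemma N_tD:
  assumes "g \<in> N_t R"
  shows "poly_over R g" "g \<noteq> 0" "to_fract g \<noteq> 0" "\<And>M. M \<in> t_Max R \<Longrightarrow> \<not> poly_over M g"
  using assms N_t_iff[of g] by (auto simp: N_t_def)

lemma N_t_one: "1 \<in> N_t R"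
proof -
  have "poly_over R 1" using poly_over_const[OF submod_self[OF dom] dom_one[OF dom]] by (simp flip: one_pCons)
  moreover have "\<not> poly_over M 1" if "M \<in> t_Max R" for M
  proof
    assume "poly_over M 1"
    then have "coeff 1 0 \<in> M" unfolding poly_over_def by blast
    then show False using t_MaxD(4)[OF that] by simp
  qed
  ultimately show ?thesis unfolding N_t_iff by blast
qed

lemma N_t_mult: "f \<in> N_t R \<Longrightarrow> g \<in> N_t R \<Longrightarrow> f * g \<in> N_t R"
  using poly_over_prime[OF t_Max_prime dom] poly_over_mult[OF submod_self[OF dom]]
  unfolding N_t_iff by blast

text \<open>A t-ideal M that contained S would contain the v-closure of S, and so 1.\<close>

lemma N_t_v_one:
  assumes "poly_over R f" "finite S" "S \<subseteq> range (coeff f)" "1 \<in> v_op R S"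
  shows "f \<in> N_t R"
proof -
  have "\<not> poly_over M f" if M: "M \<in> t_Max R" for M
  proof
    assume "poly_over M f"
    then have "S \<subseteq> M" using assms(3) by (auto simp: poly_over_def)
    then have "v_op R S \<subseteq> M" by (rule t_ideal_v_op[OF t_MaxD(1)[OF M] dom assms(2)])
    then show False using assms(4) t_MaxD(4)[OF M] by blast
  qed
  then show ?thesis using assms(1) unfolding N_t_iff by blast
qed

lemma ext_add:
  assumes I: "submod R I" and "x \<in> ext R I" "y \<in> ext R I"
  shows "x + y \<in> ext R I"
proof -
  obtain f g where f: "poly_over I f" "g \<in> N_t R" "x = to_fract f / to_fract g"
    using assms(2) by (rule extE)
  obtain f' g' where f': "poly_over I f'" "g' \<in> N_t R" "y = to_fract f' / to_fract g'"
    using assms(3) by (rule extE)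
  have "x + y = to_fract (g' * f + g * f') / to_fract (g * g')"
    using N_tD(3)[OF f(2)] N_tD(3)[OF f'(2)] f(3) f'(3) by (simp add: field_simps)
  also have "\<dots> \<in> ext R I"
    by (intro extI N_t_mult poly_over_add[OF I] poly_over_mult[OF I] f f' N_tD(1))
  finally show ?thesis .
qed

lemma ext_mult:
  assumes I: "submod R I" and "x \<in> ext R R" "y \<in> ext R I"
  shows "x * y \<in> ext R I"
proof -
  obtain f g where f: "poly_over R f" "g \<in> N_t R" "x = to_fract f / to_fract g"
    using assms(2) by (rule extE)
  obtain f' g' where f': "poly_over I f'" "g' \<in> N_t R" "y = to_fract f' / to_fract g'"
    using assms(3) by (rule extE)
  have "x * y = to_fract (f * f') / to_fract (g * g')" using f(3) f'(3) by simp
  also have "\<dots> \<in> ext R I" by (intro extI N_t_mult poly_over_mult[OF I] f f')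
  finally show ?thesis .
qed

lemma to_fract_ext: "poly_over I f \<Longrightarrow> to_fract f \<in> ext R I"
  using extI[OF _ N_t_one, of I f] by simp

lemma emb_ext: "submod R I \<Longrightarrow> a \<in> I \<Longrightarrow> emb a \<in> ext R I"
  unfolding emb_def by (intro to_fract_ext poly_over_const)

lemma submod_ext:
  assumes "submod R I"
  shows "submod (RX R) (ext R I)"
  unfolding RX_eq_ext
  using emb_ext[OF assms submod_zero[OF assms]] ext_add[OF assms] ext_mult[OF assms]
  by (intro submodI) simp_all

lemma dom_RX: "dom_in (RX R)"
proof -
  have neg: "- x \<in> RX R" if "x \<in> RX R" for x
    using ext_mult[OF submod_self[OF dom], of "emb (- 1)" x] that
      emb_ext[OF submod_self[OF dom], of "- 1"] dom_uminus[OF dom dom_one[OF dom]]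
    unfolding RX_eq_ext by simp
  show ?thesis
    unfolding dom_in_def
    using neg ext_add[OF submod_self[OF dom]] ext_mult[OF submod_self[OF dom]]
      emb_ext[OF submod_self[OF dom] dom_one[OF dom]]
    by (simp add: RX_eq_ext)
qed

lemma RX_poly: "poly_over R f \<Longrightarrow> to_fract f \<in> RX R"
  unfolding RX_eq_ext by (rule to_fract_ext)

lemma RX_emb: "a \<in> R \<Longrightarrow> emb a \<in> RX R"
  unfolding RX_eq_ext by (intro emb_ext submod_self dom)

lemma RX_inverse_N_t: "g \<in> N_t R \<Longrightarrow> inverse (to_fract g) \<in> RX R"
  using extI[of R 1 g R] poly_over_const[OF submod_self[OF dom] dom_one[OF dom]]
  unfolding RX_eq_ext by (simp add: divide_inverse flip: one_pCons)

text \<open>If \<open>emb x\<close> is f / g, then x g = f, so every coefficient of g multiplies x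
  into I, and for each M one of them is outside M. Conversely the finite set of multipliers from
  \<open>w_op_v_one\<close> becomes the coefficients of a denominator g in \<open>N_t\<close>, with
  numerator x g.\<close>

lemma emb_ext_iff:
  assumes I: "submod R I" "I \<subseteq> QF R"
  shows "emb x \<in> ext R I \<longleftrightarrow> x \<in> w_op R I"
proof
  assume "emb x \<in> ext R I"
  then obtain f g where f: "poly_over I f" "g \<in> N_t R" "emb x = to_fract f / to_fract g"
    by (rule extE)
  have "to_fract (smult x g) = to_fract f" unfolding to_fract_smult
    using f(3) N_tD(3)[OF f(2)] by (simp add: field_simps)
  then have "smult x g = f" unfolding to_fract_eq_iff .
  then have xg: "x * coeff g i \<in> I" for i using f(1) by (auto simp: poly_over_def)
  have gR: "coeff g i \<in> R" for i using N_tD(1)[OF f(2)] by (simp add: poly_over_def)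
  obtain i where i: "coeff g i \<noteq> 0" using N_tD(2)[OF f(2)] by (meson leading_coeff_0_iff)
  have "(x * coeff g i) / coeff g i \<in> QF R"
    using xg[of i] gR[of i] I(2) sub_QF[OF dom] by (intro QF_divide[OF dom]) auto
  then have "x \<in> QF R" using i by simp
  moreover have "\<exists>u\<in>R - M. u * x \<in> I" if M: "M \<in> t_Max R" for M
  proof -
    obtain j where "coeff g j \<notin> M" using N_tD(4)[OF f(2) M] by (auto simp: poly_over_def)
    then show ?thesis using gR[of j] xg[of j] by (intro bexI[of _ "coeff g j"]) (auto simp: mult.commute)
  qed
  ultimately show "x \<in> w_op R I" unfolding w_op_iff by blast
next
  assume "x \<in> w_op R I"
  from w_op_v_one[OF I(1) this]
  obtain S where S: "finite S" "S \<subseteq> R" "1 \<in> v_op R S" "\<And>s. s \<in> S \<Longrightarrow> x * s \<in> I" by blast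
  obtain xs where xs: "set xs = S" using S(1) finite_list by blast
  \<comment> \<open>Positions past the end of the list read as 0, hence the extra element.\<close>
  have cf: "coeff (Poly xs) i \<in> insert 0 S" for i
    using xs by (auto simp: nth_default_def)
  have "S \<subseteq> range (coeff (Poly xs))"
  proof
    fix s assume "s \<in> S"
    then obtain i where "i < length xs" "xs ! i = s" using xs by (metis in_set_conv_nth)
    then have "s = coeff (Poly xs) i" by (simp add: nth_default_def)
    then show "s \<in> range (coeff (Poly xs))" by blast
  qed
  moreover have "coeff (Poly xs) i \<in> R" for i using cf[of i] S(2) dom_zero[OF dom] by (metis insertE subsetD)
  then have "poly_over R (Poly xs)" unfolding poly_over_def by blast
  ultimately have N: "Poly xs \<in> N_t R" using S by (intro N_t_v_one)
  have "x * coeff (Poly xs) i \<in> I" for i using cf[of i] S(4) submod_zero[OF I(1)] by auto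
  then have "poly_over I (smult x (Poly xs))" unfolding poly_over_def by simp
  from extI[OF this N] show "emb x \<in> ext R I" using N_tD(3)[OF N] by (simp add: to_fract_smult)
qed

lemma emb_RX_iff: "emb x \<in> RX R \<longleftrightarrow> x \<in> R"
  using emb_ext_iff[OF submod_self[OF dom] sub_QF[OF dom]] unfolding RX_eq_ext w_op_R .

text \<open>Horner induction; it works because the variable itself belongs to T.\<close>

lemma poly_in_submod:
  assumes J: "submod (RX R) J" and "\<And>i. emb (coeff f i) \<in> J"
  shows "to_fract f \<in> J"
  using assms(2)
proof (induction f)
  case 0
  then show ?case using submod_zero[OF J] by simp
next
  case (pCons a p)
  have "emb (coeff p i) \<in> J" for i using pCons.prems[of "Suc i"] by simp
  then have "to_fract p \<in> J" by (rule pCons.IH)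
  then have "to_fract (monom 1 1) * to_fract p \<in> J"
    using submod_mult[OF J RX_poly[OF poly_over_monom[OF dom]]] by blast
  moreover have "emb a \<in> J" using pCons.prems[of 0] by simp
  ultimately show ?case unfolding to_fract_pCons using submod_add[OF J] by blast
qed

text \<open>Elements of \<open>N_t\<close> are units of T, so a fraction lies in J as soon as its
  numerator does.\<close>

lemma ext_least:
  assumes J: "submod (RX R) J" and "\<And>a. a \<in> I \<Longrightarrow> emb a \<in> J"
  shows "ext R I \<subseteq> J"
proof
  fix x assume "x \<in> ext R I"
  then obtain f g where f: "poly_over I f" "g \<in> N_t R" "x = to_fract f / to_fract g" by (rule extE)
  have "to_fract f \<in> J" using f(1) assms(2) by (intro poly_in_submod[OF J]) (auto simp: poly_over_def)
  then have "inverse (to_fract g) * to_fract f \<in> J"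
    by (rule submod_mult[OF J RX_inverse_N_t[OF f(2)]])
  then show "x \<in> J" using f(3) by (simp add: divide_inverse mult.commute)
qed

text \<open>Read through \<open>emb_ext_iff\<close>, the w-closure is the trace of a T-submodule on
  the field and inherits the module laws. Idempotence in \<open>w_op_idem\<close> comes from the
  same reading.\<close>

lemma submod_w_op:
  assumes I: "submod R I" "I \<subseteq> QF R"
  shows "submod R (w_op R I)"
proof -
  note E = submod_ext[OF I(1)]
  show ?thesis
    by (rule submodI; unfold emb_ext_iff[OF I, symmetric])
       (use submod_zero[OF E] submod_add[OF E] submod_mult[OF E RX_emb] in simp_all)
qed

lemma w_op_sub_QF: "w_op R I \<subseteq> QF R"
  by (rule subsetI) (simp add: w_op_iff)

lemma ext_w_op:
  assumes I: "submod R I" "I \<subseteq> QF R"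
  shows "ext R (w_op R I) = ext R I"
proof
  show "ext R (w_op R I) \<subseteq> ext R I"
    using emb_ext_iff[OF I] by (intro ext_least submod_ext I) blast
  show "ext R I \<subseteq> ext R (w_op R I)" by (intro ext_mono w_op_superset I)
qed

lemma w_op_idem:
  assumes I: "submod R I" "I \<subseteq> QF R"
  shows "w_op R (w_op R I) = w_op R I"
proof (rule set_eqI)
  fix x
  show "x \<in> w_op R (w_op R I) \<longleftrightarrow> x \<in> w_op R I"
    using emb_ext_iff[OF I, of x] emb_ext_iff[OF submod_w_op[OF I] w_op_sub_QF, of x]
    unfolding ext_w_op[OF I] by simp
qed

lemma w_op_mono: "I \<subseteq> J \<Longrightarrow> w_op R I \<subseteq> w_op R J"
  by (rule subsetI) (unfold w_op_iff, blast)

lemma w_ideal_w_op: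
  assumes "is_ideal R I" "I \<noteq> {0}"
  shows "w_ideal R (w_op R I)"
proof -
  have I: "submod R I" "I \<subseteq> R" "I \<subseteq> QF R" using assms sub_QF[OF dom] by (auto simp: is_ideal_iff)
  have "w_op R I \<subseteq> R" using w_op_mono[OF I(2)] w_op_R by simp
  moreover have "w_op R I \<noteq> {0}" using w_op_superset[OF I(3)] assms(2) submod_zero[OF I(1)] by blast
  ultimately show ?thesis
    unfolding w_ideal_def is_ideal_iff using submod_w_op[OF I(1,3)] w_op_idem[OF I(1,3)] by simp
qed

lemma ext_eq_iff:
  assumes "submod R A" "A \<subseteq> QF R" "submod R B" "B \<subseteq> QF R"
  shows "ext R A = ext R B \<longleftrightarrow> w_op R A = w_op R B"
proof
  assume "ext R A = ext R B"
  then show "w_op R A = w_op R B"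
    using emb_ext_iff[OF assms(1,2)] emb_ext_iff[OF assms(3,4)] by auto
next
  assume "w_op R A = w_op R B"
  then show "ext R A = ext R B" using ext_w_op[OF assms(1,2)] ext_w_op[OF assms(3,4)] by simp
qed

lemma emb_QF: "x \<in> QF R \<Longrightarrow> emb x \<in> QF (RX R)"
  by (elim QF_E) (auto intro!: QF_I RX_emb)

lemma ext_sub_QF: "I \<subseteq> QF R \<Longrightarrow> ext R I \<subseteq> QF (RX R)"
  by (intro ext_least submod_QF dom_RX emb_QF) blast

lemma w_idealD:
  assumes "w_ideal R I"
  shows "is_ideal R I" "submod R I" "I \<subseteq> R" "I \<subseteq> QF R" "I \<noteq> {0}" "w_op R I = I"
  using assms sub_QF[OF dom] by (auto simp: w_ideal_def is_ideal_iff)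

lemma emb_ext_w_ideal: "w_ideal R I \<Longrightarrow> emb x \<in> ext R I \<longleftrightarrow> x \<in> I"
  using emb_ext_iff w_idealD by metis

lemma ext_subset_iff:
  assumes A: "w_ideal R A" and B: "w_ideal R B"
  shows "ext R A \<subseteq> ext R B \<longleftrightarrow> A \<subseteq> B"
proof
  assume "ext R A \<subseteq> ext R B"
  then show "A \<subseteq> B" using emb_ext_w_ideal[OF A] emb_ext_w_ideal[OF B] by blast
qed (rule ext_mono)

lemma ideal_ext: "is_ideal R I \<Longrightarrow> is_ideal (RX R) (ext R I)"
  unfolding is_ideal_iff by (simp add: submod_ext) (simp add: RX_eq_ext ext_mono)

lemma ext_nonzero: "submod R I \<Longrightarrow> I \<noteq> {0} \<Longrightarrow> ext R I \<noteq> {0}"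
  using emb_ext[of I] submod_zero[of R I] emb_simps(7) by blast

text \<open>Membership must not depend on the chosen representation. Cross-multiplying two of them
  puts f g' into P[X]; the denominator g' is outside M[X], hence outside the prime P[X], which
  leaves f.\<close>

lemma ext_prime_iff:
  assumes P: "prime_ideal R P" and M: "M \<in> t_Max R" "P \<subseteq> M"
    and f: "poly_over R f" and g: "g \<in> N_t R"
  shows "to_fract f / to_fract g \<in> ext R P \<longleftrightarrow> poly_over P f"
proof
  assume "to_fract f / to_fract g \<in> ext R P"
  then obtain f' g' where f': "poly_over P f'" "g' \<in> N_t R"
    "to_fract f / to_fract g = to_fract f' / to_fract g'" by (rule extE)
  have "to_fract (f * g') = to_fract (g * f')"
    using f'(3) N_tD(3)[OF g] N_tD(3)[OF f'(2)] by (simp add: field_simps)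
  then have "f * g' = g * f'" unfolding to_fract_eq_iff .
  moreover have "poly_over P (g * f')"
    using P f' N_tD(1)[OF g] by (intro poly_over_mult) (auto simp: prime_ideal_def is_ideal_iff)
  ultimately have "poly_over P f \<or> poly_over P g'"
    using poly_over_prime[OF P dom f N_tD(1)[OF f'(2)]] by simp
  then show "poly_over P f" using N_tD(4)[OF f'(2) M(1)] poly_over_mono[OF M(2)] by blast
qed (rule extI[OF _ g])

text \<open>The coefficients of all polynomials in J form an ideal C of R. If C lay in no maximal
  t-ideal, finitely many of these coefficients would have 1 in their v-closure; merging the
  polynomials they come from gives an element of J in \<open>N_t\<close>, a unit of T.\<close>

lemma ideal_in_ext_t_Max:
  assumes J: "is_ideal (RX R) J" "J \<noteq> RX R"
  obtains M where "M \<in> t_Max R" "J \<subseteq> ext R M"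
proof -
  have sJ: "submod (RX R) J" using J by (simp add: is_ideal_iff)
  define C where "C = {coeff f i | f i. poly_over R f \<and> to_fract f \<in> J}"
  have "submod R C"
  proof (rule submodI)
    have "poly_over R 0" "to_fract 0 \<in> J" using poly_over_0[OF submod_self[OF dom]] submod_zero[OF sJ] by auto
    then show "0 \<in> C" unfolding C_def by (force intro: exI[of _ "0::'a poly"])
  next
    fix a b assume "a \<in> C" "b \<in> C"
    then obtain f i g j where e: "a = coeff f i" "poly_over R f" "to_fract f \<in> J"
      "b = coeff g j" "poly_over R g" "to_fract g \<in> J" unfolding C_def by blast
    \<comment> \<open>The monomials bring coefficient i of f and coefficient j of g to the common
      index i + j.\<close>
    let ?h = "monom 1 j * f + monom 1 i * g"
    have "poly_over R ?h"
      by (intro poly_over_add[OF submod_self[OF dom]] poly_over_mult[OF submod_self[OF dom]]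
          poly_over_monom dom e)
    moreover have "to_fract ?h \<in> J"
      unfolding to_fract_add to_fract_mult
      by (intro submod_add[OF sJ] submod_mult[OF sJ] RX_poly poly_over_monom dom e)
    moreover have "a + b = coeff ?h (i + j)" using e by (simp add: coeff_monom_mult)
    ultimately show "a + b \<in> C" unfolding C_def by blast
  next
    fix r a assume r: "r \<in> R" and "a \<in> C"
    then obtain f i where e: "a = coeff f i" "poly_over R f" "to_fract f \<in> J" unfolding C_def by blast
    have "poly_over R (smult r f)" using e(2) r by (rule poly_over_smult[OF dom_mult[OF dom], rotated 2])
    moreover have "to_fract (smult r f) \<in> J" unfolding to_fract_smult
      by (rule submod_mult[OF sJ RX_emb[OF r] e(3)])
    moreover have "r * a = coeff (smult r f) i" using e by simp
    ultimately show "r * a \<in> C" unfolding C_def by blast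
  qed
  moreover have "C \<subseteq> R" by (auto simp: C_def poly_over_def)
  ultimately have C: "is_ideal R C" by (simp add: is_ideal_iff)
  have "\<exists>M\<in>t_Max R. C \<subseteq> M"
  proof (rule ccontr)
    assume "\<not> (\<exists>M\<in>t_Max R. C \<subseteq> M)"
    then have "\<not> C \<subseteq> M" if "M \<in> t_Max R" for M using that by blast
    from ideal_v_one[OF C this] obtain S where S: "finite S" "S \<subseteq> C" "1 \<in> v_op R S" .
    have "\<exists>f. poly_over R f \<and> to_fract f \<in> J \<and> S \<subseteq> range (coeff f)" using S(1,2)
    proof (induction S)
      case empty
      then show ?case using poly_over_0[OF submod_self[OF dom]] submod_zero[OF sJ]
        by (intro exI[of _ 0]) auto
    next
      case (insert a S)
      then obtain f where f: "poly_over R f" "to_fract f \<in> J" "S \<subseteq> range (coeff f)" by blast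
      obtain g where g: "poly_over R g" "to_fract g \<in> J" "a \<in> range (coeff g)"
        using insert.prems unfolding C_def by blast
      let ?h = "f + monom 1 (Suc (degree f)) * g"
      have "poly_over R ?h"
        by (intro poly_over_add[OF submod_self[OF dom]] poly_over_mult[OF submod_self[OF dom]]
            poly_over_monom dom f g)
      moreover have "to_fract ?h \<in> J"
        unfolding to_fract_add to_fract_mult
        by (intro submod_add[OF sJ] submod_mult[OF sJ] RX_poly poly_over_monom dom f g)
      moreover have "insert a S \<subseteq> range (coeff ?h)"
        using subset_trans[OF f(3) range_coeff_merge(1)] subsetD[OF range_coeff_merge(2) g(3)]
        by (simp only: insert_subset)
      ultimately show ?case by (intro exI[of _ ?h] conjI)
    qed
    then obtain f where f: "poly_over R f" "to_fract f \<in> J" "S \<subseteq> range (coeff f)" by blast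
    have N: "f \<in> N_t R" by (rule N_t_v_one[OF f(1) S(1) f(3) S(3)])
    have "inverse (to_fract f) * to_fract f \<in> J"
      by (rule submod_mult[OF sJ RX_inverse_N_t[OF N] f(2)])
    then have "1 \<in> J" using N_tD(3)[OF N] by simp
    then show False using J ideal_eq_whole[OF J(1)] by blast
  qed
  then obtain M where M: "M \<in> t_Max R" "C \<subseteq> M" by blast
  have "J \<subseteq> ext R M"
  proof
    fix x assume x: "x \<in> J"
    then have "x \<in> ext R R" using J(1) by (auto simp: is_ideal_iff RX_eq_ext)
    then obtain f g where f: "poly_over R f" "g \<in> N_t R" "x = to_fract f / to_fract g" by (rule extE)
    have "to_fract g * x \<in> J" by (rule submod_mult[OF sJ RX_poly[OF N_tD(1)[OF f(2)]] x])
    then have "to_fract f \<in> J" using f(3) N_tD(3)[OF f(2)] by simp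
    then have "coeff f i \<in> C" for i using f(1) unfolding C_def by blast
    then have "poly_over M f" using M(2) by (auto simp: poly_over_def)
    then show "x \<in> ext R M" unfolding f(3) by (rule extI[OF _ f(2)])
  qed
  with M(1) show ?thesis by (rule that)
qed

lemma t_Max_w_ideal: "M \<in> t_Max R \<Longrightarrow> w_ideal R M"
  by (intro t_ideal_w_ideal t_MaxD)

lemma t_Max_maximal: "M \<in> t_Max R \<Longrightarrow> N \<in> t_Max R \<Longrightarrow> M \<subseteq> N \<Longrightarrow> M = N"
  unfolding t_Max_def by blast

lemma ext_t_Max_proper:
  assumes M: "M \<in> t_Max R"
  shows "ext R M \<noteq> RX R"
proof
  assume "ext R M = RX R"
  then have "emb 1 \<in> ext R M" using dom_one[OF dom_RX] by simp
  then show False using emb_ext_w_ideal[OF t_Max_w_ideal[OF M]] t_MaxD(4)[OF M] by blast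
qed

lemma ideal_ext_t_Max: "M \<in> t_Max R \<Longrightarrow> is_ideal (RX R) (ext R M)"
  using ideal_ext w_idealD(1)[OF t_Max_w_ideal] by blast

text \<open>Every proper ideal of T lies in some \<open>ext R M\<close>, and contraction shows that
  these are pairwise incomparable.\<close>

lemma Max_ideals_RX: "Max_ideals (RX R) = ext R ` t_Max R"
proof
  show "Max_ideals (RX R) \<subseteq> ext R ` t_Max R"
  proof
    fix J assume J: "J \<in> Max_ideals (RX R)"
    then have "is_ideal (RX R) J" "J \<noteq> RX R" by (auto simp: Max_ideals_def)
    from ideal_in_ext_t_Max[OF this] obtain M where M: "M \<in> t_Max R" "J \<subseteq> ext R M" .
    then have "ext R M = J" using J ideal_ext_t_Max[OF M(1)] ext_t_Max_proper[OF M(1)]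
      unfolding Max_ideals_def by blast
    then show "J \<in> ext R ` t_Max R" using M(1) by blast
  qed
  show "ext R ` t_Max R \<subseteq> Max_ideals (RX R)"
  proof
    fix J assume "J \<in> ext R ` t_Max R"
    then obtain M where M: "M \<in> t_Max R" "J = ext R M" by blast
    have "K = J" if K: "is_ideal (RX R) K" "K \<noteq> RX R" "J \<subseteq> K" for K
    proof -
      from ideal_in_ext_t_Max[OF K(1,2)] obtain N where N: "N \<in> t_Max R" "K \<subseteq> ext R N" .
      then have "ext R M \<subseteq> ext R N" using K(3) M(2) by blast
      then have "M = N"
        using ext_subset_iff[OF t_Max_w_ideal[OF M(1)] t_Max_w_ideal[OF N(1)]]
          t_Max_maximal[OF M(1) N(1)] by blast
      then show "K = J" using N K M by blast
    qed
    then show "J \<in> Max_ideals (RX R)"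
      unfolding Max_ideals_def using M ideal_ext_t_Max[OF M(1)] ext_t_Max_proper[OF M(1)] by blast
  qed
qed

lemma inj_on_ext_t_Max: "inj_on (ext R) (t_Max R)"
  by (intro inj_onI) (metis ext_subset_iff t_Max_w_ideal subset_antisym order_refl)

lemma finite_character_iff: "t_finite_character R \<longleftrightarrow> finite_character (RX R)"
proof
  assume fc: "t_finite_character R"
  show "finite_character (RX R)" unfolding finite_character_def
  proof (intro ballI impI)
    fix x assume x: "x \<in> RX R" "x \<noteq> 0"
    then obtain f g where f: "poly_over R f" "g \<in> N_t R" "x = to_fract f / to_fract g"
      unfolding RX_eq_ext by (elim extE)
    \<comment> \<open>One nonzero coefficient suffices: x in \<open>ext R M\<close> forces all
      coefficients of f into M, so every such M is among the finitely many containing this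
      one.\<close>
    then obtain i where i: "coeff f i \<noteq> 0" using x(2) by (metis leading_coeff_0_iff to_fract_0 divide_eq_0_iff)
    have "coeff f i \<in> R" using f(1) by (simp add: poly_over_def)
    then have fin: "finite {M \<in> t_Max R. coeff f i \<in> M}" using fc i by (simp add: t_finite_character_def)
    have "{N \<in> Max_ideals (RX R). x \<in> N} \<subseteq> ext R ` {M \<in> t_Max R. coeff f i \<in> M}"
    proof
      fix N assume "N \<in> {N \<in> Max_ideals (RX R). x \<in> N}"
      then obtain M where M: "M \<in> t_Max R" "N = ext R M" "x \<in> ext R M" unfolding Max_ideals_RX by blast
      then have "poly_over M f"
        using ext_prime_iff[OF t_Max_prime[OF M(1)] M(1) order_refl f(1,2)] f(3) by simp
      then show "N \<in> ext R ` {M \<in> t_Max R. coeff f i \<in> M}" using M by (simp add: poly_over_def)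
    qed
    then show "finite {N \<in> Max_ideals (RX R). x \<in> N}" using fin finite_surj by blast
  qed
next
  assume fc: "finite_character (RX R)"
  show "t_finite_character R" unfolding t_finite_character_def
  proof (intro ballI impI)
    fix x assume x: "x \<in> R" "x \<noteq> 0"
    then have "finite {N \<in> Max_ideals (RX R). emb x \<in> N}"
      using fc RX_emb[of x] by (simp add: finite_character_def)
    moreover have "ext R ` {M \<in> t_Max R. x \<in> M} \<subseteq> {N \<in> Max_ideals (RX R). emb x \<in> N}"
      unfolding Max_ideals_RX using emb_ext_w_ideal[OF t_Max_w_ideal] by blast
    ultimately have "finite (ext R ` {M \<in> t_Max R. x \<in> M})" by (rule finite_subset[rotated])
    then show "finite {M \<in> t_Max R. x \<in> M}"
      by (rule finite_imageD) (rule inj_on_subset[OF inj_on_ext_t_Max], blast)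
  qed
qed

end

section \<open>PvMDs and Pruefer domains\<close>

context proper_domain
begin

lemma t_Max_nonzero: "M \<in> t_Max R \<Longrightarrow> u \<notin> M \<Longrightarrow> u \<noteq> 0"
  using t_MaxD(5) by blast

text \<open>The valuation condition with denominators cleared; it relies on R and its localization
  at M having the same quotient field.\<close>

lemma PvMD_iff:
  "PvMD R \<longleftrightarrow> (\<forall>M\<in>t_Max R. \<forall>a\<in>R. \<forall>b\<in>R. a \<noteq> 0 \<longrightarrow> b \<noteq> 0 \<longrightarrow>
     (\<exists>u\<in>R - M. u * (a / b) \<in> R \<or> u * (b / a) \<in> R))"
proof -
  have loc: "x \<in> loc_mod R M R \<longleftrightarrow> (\<exists>u\<in>R - M. u * x \<in> R)" if M: "M \<in> t_Max R" for M x
  proof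
    assume "x \<in> loc_mod R M R"
    then obtain e s where e: "x = e / s" "e \<in> R" "s \<in> R" "s \<notin> M" by (auto simp: loc_mod_def)
    then show "\<exists>u\<in>R - M. u * x \<in> R"
      using t_Max_nonzero[OF M e(4)] by (intro bexI[of _ s]) auto
  next
    assume "\<exists>u\<in>R - M. u * x \<in> R"
    then obtain u where u: "u \<in> R" "u \<notin> M" "u * x \<in> R" by blast
    then have "x = (u * x) / u" using t_Max_nonzero[OF M u(2)] by simp
    then show "x \<in> loc_mod R M R" using u unfolding loc_mod_def by blast
  qed
  have QF_loc: "QF (loc_mod R M R) = QF R" if M: "M \<in> t_Max R" for M
  proof
    show "QF (loc_mod R M R) \<subseteq> QF R"
    proof
      fix x assume "x \<in> QF (loc_mod R M R)"
      then obtain a b where ab: "a \<in> loc_mod R M R" "b \<in> loc_mod R M R" "x = a / b" by (elim QF_E)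
      have "y \<in> QF R" if "y \<in> loc_mod R M R" for y
        using that t_Max_nonzero[OF M] unfolding loc_mod_def by (auto intro: QF_I)
      then show "x \<in> QF R" unfolding ab(3) using ab(1,2) by (intro QF_divide[OF dom])
    qed
    have "R \<subseteq> loc_mod R M R"
      using loc[OF M] dom_one[OF dom] t_MaxD(4)[OF M] by (metis DiffI mult_1 subsetI)
    then show "QF R \<subseteq> QF (loc_mod R M R)" unfolding QF_def by blast
  qed
  have "valuation_dom (loc_mod R M R) \<longleftrightarrow>
      (\<forall>a\<in>R. \<forall>b\<in>R. a \<noteq> 0 \<longrightarrow> b \<noteq> 0 \<longrightarrow> (\<exists>u\<in>R - M. u * (a / b) \<in> R \<or> u * (b / a) \<in> R))" (is "_ \<longleftrightarrow> ?r")
    if M: "M \<in> t_Max R" for M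
  proof
    assume v: "valuation_dom (loc_mod R M R)"
    show ?r
    proof (intro ballI impI)
      fix a b assume ab: "a \<in> R" "b \<in> R" "a \<noteq> 0" "b \<noteq> 0"
      then have "a / b \<in> QF R" by (intro QF_I)
      then have "a / b \<in> loc_mod R M R \<or> inverse (a / b) \<in> loc_mod R M R"
        using v ab unfolding valuation_dom_def QF_loc[OF M] by (metis divide_eq_0_iff)
      then show "\<exists>u\<in>R - M. u * (a / b) \<in> R \<or> u * (b / a) \<in> R"
        unfolding loc[OF M] inverse_divide by blast
    qed
  next
    assume r: ?r
    show "valuation_dom (loc_mod R M R)" unfolding valuation_dom_def QF_loc[OF M]
    proof (intro ballI impI)
      fix x assume "x \<in> QF R" "x \<noteq> 0"
      then obtain a b where ab: "a \<in> R" "b \<in> R" "b \<noteq> 0" "x = a / b" by (elim QF_E)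
      then have "a \<noteq> 0" using \<open>x \<noteq> 0\<close> by auto
      then have "\<exists>u\<in>R - M. u * (a / b) \<in> R \<or> u * (b / a) \<in> R" using r ab by blast
      then show "x \<in> loc_mod R M R \<or> inverse x \<in> loc_mod R M R"
        unfolding loc[OF M] ab(4) inverse_divide by blast
    qed
  qed
  then show ?thesis unfolding PvMD_def by blast
qed

text \<open>Comparability in the localization at M, written without division so that zero elements
  are covered.\<close>

lemma PvMD_dichotomy:
  assumes V: "PvMD R" and M: "M \<in> t_Max R" and xy: "x \<in> QF R" "y \<in> QF R"
  shows "\<exists>u\<in>R - M. (\<exists>r\<in>R. u * x = r * y) \<or> (\<exists>r\<in>R. u * y = r * x)"
proof (cases "x = 0 \<or> y = 0")
  case True
  then show ?thesis
    using dom_one[OF dom] t_MaxD(4)[OF M] dom_zero[OF dom] by (intro bexI[of _ 1]) auto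
next
  case False
  have "x / y \<in> QF R" using xy by (rule QF_divide[OF dom])
  then obtain a b where ab: "a \<in> R" "b \<in> R" "b \<noteq> 0" "x / y = a / b" by (elim QF_E)
  then have "a \<noteq> 0" using False by auto
  then obtain u where u: "u \<in> R - M" "u * (a / b) \<in> R \<or> u * (b / a) \<in> R"
    using V M ab unfolding PvMD_iff by blast
  have "u * x = (u * (a / b)) * y" using False by (simp flip: ab(4))
  moreover have "b / a = y / x" using ab(4) False ab(3) \<open>a \<noteq> 0\<close> by (simp add: field_simps)
  then have "u * y = (u * (b / a)) * x" using False by simp
  ultimately show ?thesis using u by blast
qed

text \<open>In a valuation ring a finite set has a member dividing all others. Each comparison
  brings its own denominator; a product of elements outside the prime M gives the common one
  u.\<close>

lemma PvMD_local_generator: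
  assumes V: "PvMD R" and M: "M \<in> t_Max R" and S: "finite S" "S \<noteq> {}" "S \<subseteq> QF R"
  shows "\<exists>s\<in>S. \<exists>u\<in>R - M. \<forall>a\<in>S. \<exists>r\<in>R. u * a = r * s"
  using S
proof (induction S rule: finite_ne_induct)
  case (singleton x)
  then show ?case using dom_one[OF dom] t_MaxD(4)[OF M] by auto
next
  case (insert x S)
  then obtain s u where s: "s \<in> S" "u \<in> R" "u \<notin> M" "\<And>a. a \<in> S \<Longrightarrow> \<exists>r\<in>R. u * a = r * s" by blast
  have "x \<in> QF R" "s \<in> QF R" using insert.prems s(1) by auto
  then obtain w where w: "w \<in> R" "w \<notin> M" "(\<exists>r\<in>R. w * x = r * s) \<or> (\<exists>r\<in>R. w * s = r * x)"
    using PvMD_dichotomy[OF V M] by blast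
  have uw: "u * w \<in> R - M"
    using t_Max_prime[OF M] s(2,3) w(1,2) dom_mult[OF dom] unfolding prime_ideal_def by blast
  from w(3) show ?case
  proof
    assume "\<exists>r\<in>R. w * x = r * s"
    then obtain r where r: "r \<in> R" "w * x = r * s" by blast
    have "\<exists>q\<in>R. u * w * a = q * s" if a: "a \<in> insert x S" for a
    proof (cases "a = x")
      case True
      then show ?thesis using r s(2) dom_mult[OF dom]
        by (intro bexI[of _ "u * r"]) (simp_all add: mult.assoc)
    next
      case False
      then obtain q where "q \<in> R" "u * a = q * s" using s(4) a by blast
      then show ?thesis using w(1) dom_mult[OF dom]
        by (intro bexI[of _ "w * q"]) (simp_all add: mult.assoc mult.left_commute[of u])
    qed
    then show ?thesis using s(1) uw by blast
  next
    assume "\<exists>r\<in>R. w * s = r * x"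
    then obtain r where r: "r \<in> R" "w * s = r * x" by blast
    have "\<exists>q\<in>R. u * w * a = q * x" if a: "a \<in> insert x S" for a
    proof (cases "a = x")
      case True
      then show ?thesis using uw by blast
    next
      case False
      then obtain q where q: "q \<in> R" "u * a = q * s" using s(4) a by blast
      have "u * w * a = w * (u * a)" by (simp add: mult_ac)
      also have "\<dots> = q * (w * s)" using q by (simp add: mult_ac)
      also have "\<dots> = q * r * x" using r by (simp add: mult_ac)
      finally show ?thesis using q(1) r(1) dom_mult[OF dom] by blast
    qed
    then show ?thesis using uw by blast
  qed
qed

text \<open>The Gauss-type lemma at the heart of the correspondence: in a PvMD a polynomial and its
  content generate the same submodule over the Nagata-type ring, because locally at each
  maximal t-ideal one coefficient divides all others.\<close>

lemma PvMD_coeff_multiple: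
  assumes V: "PvMD R" and f: "poly_over (QF R) f"
  shows "\<exists>t\<in>RX R. emb (coeff f i) = t * to_fract f"
proof -
  have 0: "0 \<in> RX R" by (rule dom_zero[OF dom_RX])
  \<comment> \<open>The ideal of multipliers that carry the coefficient into the cyclic module Tf;
    it is all of T once no \<open>ext R M\<close> contains it.\<close>
  let ?J = "{t \<in> RX R. \<exists>t'\<in>RX R. t * emb (coeff f i) = t' * to_fract f}"
  have J: "is_ideal (RX R) ?J" unfolding is_ideal_iff
  proof (intro conjI submodI)
    show "0 \<in> ?J" using 0 by auto
  next
    fix s t assume "s \<in> ?J" "t \<in> ?J"
    then obtain s' t' where "s \<in> RX R" "s' \<in> RX R" "s * emb (coeff f i) = s' * to_fract f"
      "t \<in> RX R" "t' \<in> RX R" "t * emb (coeff f i) = t' * to_fract f" by blast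
    then show "s + t \<in> ?J" using dom_add[OF dom_RX]
      by (simp add: distrib_right) (metis distrib_right)
  next
    fix s t assume "s \<in> RX R" "t \<in> ?J"
    then obtain t' where "s \<in> RX R" "t \<in> RX R" "t' \<in> RX R" "t * emb (coeff f i) = t' * to_fract f" by blast
    then show "s * t \<in> ?J" using dom_mult[OF dom_RX]
      by (simp add: mult.assoc) (metis mult.assoc)
  qed blast
  have "?J = RX R"
  proof (rule ccontr)
    assume "?J \<noteq> RX R"
    from ideal_in_ext_t_Max[OF J this] obtain M where M: "M \<in> t_Max R" "?J \<subseteq> ext R M" .
    have "finite (range (coeff f))" unfolding range_coeff by simp
    moreover have "range (coeff f) \<subseteq> QF R" using f by (auto simp: poly_over_def)
    ultimately obtain k u where u: "u \<in> R" "u \<notin> M"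
      "\<And>j. \<exists>r\<in>R. u * coeff f j = r * coeff f k"
      using PvMD_local_generator[OF V M(1), of "range (coeff f)"] by auto
    have u0: "u \<noteq> 0" by (rule t_Max_nonzero[OF M(1) u(2)])
    show False
    proof (cases "coeff f k = 0")
      case True
      then have "coeff f j = 0" for j using u(3)[of j] u0 by auto
      then have "1 \<in> ?J" using 0 dom_one[OF dom_RX] by auto
      then show False using ideal_eq_whole[OF J] \<open>?J \<noteq> RX R\<close> by blast
    next
      case False
      \<comment> \<open>The factor keeps all coefficients in R and turns coefficient k, the local
        generator, into u, which is outside M.\<close>
      define g where "g = smult (u / coeff f k) f"
      have g: "poly_over R g"
        unfolding poly_over_def
      proof
        fix j
        obtain r where "r \<in> R" "u * coeff f j = r * coeff f k" using u(3)[of j] by blast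
        then show "coeff g j \<in> R" using False by (simp add: g_def)
      qed
      have gk: "coeff g k = u" using False by (simp add: g_def)
      obtain r where r: "r \<in> R" "u * coeff f i = r * coeff f k" using u(3)[of i] by blast
      \<comment> \<open>Since u times coefficient i is r times coefficient k, and coefficient k
        times g is u f, the multiplier u g lies in \<open>?J\<close>. Its own coefficient at k is
        the square of u and avoids the prime M.\<close>
      have "to_fract (smult u g) * emb (coeff f i) = emb (u * coeff f i) * to_fract g"
        by (simp add: to_fract_smult)
      also have "\<dots> = emb r * (emb (coeff f k * (u / coeff f k)) * to_fract f)"
        unfolding r(2) g_def by (simp add: to_fract_smult)
      also have "\<dots> = emb (r * u) * to_fract f" using False by simp
      finally have eq: "to_fract (smult u g) * emb (coeff f i) = emb (r * u) * to_fract f" .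
      have sg: "poly_over R (smult u g)" using g u(1) by (rule poly_over_smult[OF dom_mult[OF dom], rotated 2])
      have "to_fract (smult u g) \<in> ?J"
        using eq RX_poly[OF sg] RX_emb[OF dom_mult[OF dom r(1) u(1)]] by blast
      then have "to_fract (smult u g) / to_fract 1 \<in> ext R M" using M(2) by auto
      then have "poly_over M (smult u g)"
        using ext_prime_iff[OF t_Max_prime[OF M(1)] M(1) order_refl sg N_t_one] by blast
      then have "coeff (smult u g) k \<in> M" unfolding poly_over_def by blast
      then show False using gk u(1,2) t_Max_prime[OF M(1)] by (auto simp: prime_ideal_def)
    qed
  qed
  then have "1 \<in> ?J" using dom_one[OF dom_RX] by simp
  then show ?thesis by auto
qed

text \<open>The merged numerator h is the common divisor: its coefficients lie in Th by
  \<open>PvMD_coeff_multiple\<close>, so f and f' do too, and h is a combination of x and y because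
  f = g x and f' = g' y.\<close>

lemma PvMD_RX_Bezout:
  assumes V: "PvMD R" and xy: "x \<in> RX R" "y \<in> RX R"
  shows "\<exists>p\<in>RX R. \<exists>q\<in>RX R. \<exists>s\<in>RX R. \<exists>t\<in>RX R.
    x = s * (p * x + q * y) \<and> y = t * (p * x + q * y)"
proof -
  obtain f g where f: "poly_over R f" "g \<in> N_t R" "x = to_fract f / to_fract g"
    using xy(1) unfolding RX_eq_ext by (elim extE)
  obtain f' g' where f': "poly_over R f'" "g' \<in> N_t R" "y = to_fract f' / to_fract g'"
    using xy(2) unfolding RX_eq_ext by (elim extE)
  let ?X = "monom 1 (Suc (degree f)) :: 'a poly"
  let ?h = "f + ?X * f'"
  have h: "poly_over R ?h"
    by (intro poly_over_add[OF submod_self[OF dom]] poly_over_mult[OF submod_self[OF dom]]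
        poly_over_monom dom f f')
  let ?H = "{t * to_fract ?h | t. t \<in> RX R}"
  have H: "submod (RX R) ?H"
  proof (rule submodI)
    show "0 \<in> ?H" using dom_zero[OF dom_RX] by force
    fix a b assume "a \<in> ?H" "b \<in> ?H"
    then obtain s t where "a = s * to_fract ?h" "s \<in> RX R" "b = t * to_fract ?h" "t \<in> RX R" by blast
    then have "a + b = (s + t) * to_fract ?h" "s + t \<in> RX R"
      by (simp_all add: distrib_right dom_add[OF dom_RX])
    then show "a + b \<in> ?H" by blast
  next
    fix r a assume r: "r \<in> RX R" and "a \<in> ?H"
    then obtain s where "a = s * to_fract ?h" "s \<in> RX R" by blast
    then have "r * a = (r * s) * to_fract ?h" "r * s \<in> RX R"
      using r by (simp_all add: mult.assoc dom_mult[OF dom_RX])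
    then show "r * a \<in> ?H" by blast
  qed
  have hH: "emb a \<in> ?H" if a: "a \<in> range (coeff ?h)" for a
  proof -
    obtain i where "a = coeff ?h i" using a by blast
    moreover obtain t where "t \<in> RX R" "emb (coeff ?h i) = t * to_fract ?h"
      using PvMD_coeff_multiple[OF V poly_over_mono[OF sub_QF[OF dom] h]] by blast
    ultimately show ?thesis by blast
  qed
  have "to_fract f \<in> ?H" "to_fract f' \<in> ?H"
    by (intro poly_in_submod[OF H] hH subsetD[OF range_coeff_merge(1)] rangeI,
        intro poly_in_submod[OF H] hH subsetD[OF range_coeff_merge(2)] rangeI)
  then obtain s t where st: "s \<in> RX R" "to_fract f = s * to_fract ?h"
    "t \<in> RX R" "to_fract f' = t * to_fract ?h" by blast
  have eq: "to_fract ?h = to_fract g * x + (to_fract ?X * to_fract g') * y"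
    using N_tD(3)[OF f(2)] N_tD(3)[OF f'(2)] f(3) f'(3) by simp
  have "x = (inverse (to_fract g) * s) * to_fract ?h" "y = (inverse (to_fract g') * t) * to_fract ?h"
    using st f(3) f'(3) by (simp_all only: divide_inverse mult_ac)
  moreover have "inverse (to_fract g) * s \<in> RX R" "inverse (to_fract g') * t \<in> RX R"
    "to_fract g \<in> RX R" "to_fract ?X * to_fract g' \<in> RX R"
    by (intro dom_mult[OF dom_RX] RX_inverse_N_t RX_poly N_tD(1) poly_over_monom dom st(1,3) f(2) f'(2))+
  ultimately show ?thesis unfolding eq
    by (intro bexI[of _ "to_fract g"] bexI[of _ "to_fract ?X * to_fract g'"]
        bexI[of _ "inverse (to_fract g) * s"] bexI[of _ "inverse (to_fract g') * t"] conjI)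
qed

text \<open>Induction on the generators makes I principal with a generator d in I; then d times
  \<open>inverse d\<close> exhibits 1 in the product.\<close>

lemma PvMD_imp_Prufer_RX:
  assumes V: "PvMD R"
  shows "Prufer (RX R)"
  unfolding Prufer_def
proof (intro allI impI)
  fix I assume "is_ideal (RX R) I \<and> fg_nonzero (RX R) I"
  then obtain S where I: "is_ideal (RX R) I" "I \<noteq> {0}" "finite S" "I = span_in (RX R) S"
    unfolding fg_nonzero_def by blast
  let ?T = "RX R"
  have sI: "submod ?T I" "I \<subseteq> ?T" using I(1) by (simp_all add: is_ideal_iff)
  have "S \<subseteq> I" using span_superset[OF dom_RX] I(4) by blast
  with I(3) have "\<exists>d\<in>I. \<forall>s\<in>S. \<exists>t\<in>?T. s = t * d"
  proof (induction S rule: finite_induct)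
    case empty
    then show ?case using submod_zero[OF sI(1)] by blast
  next
    case (insert x S)
    then obtain d where d: "d \<in> I" "\<And>s. s \<in> S \<Longrightarrow> \<exists>t\<in>?T. s = t * d" by blast
    have x: "x \<in> I" using insert.prems by blast
    then obtain p q s t where e: "p \<in> ?T" "q \<in> ?T" "s \<in> ?T" "t \<in> ?T"
      "x = s * (p * x + q * d)" "d = t * (p * x + q * d)"
      using PvMD_RX_Bezout[OF V, of x d] d(1) sI(2) by blast
    let ?d = "p * x + q * d"
    have "?d \<in> I" using e x d(1) by (intro submod_add[OF sI(1)] submod_mult[OF sI(1)])
    moreover have "\<exists>t\<in>?T. y = t * ?d" if "y \<in> insert x S" for y
    proof (cases "y = x")
      case True
      then show ?thesis using e by blast
    next
      case False
      then obtain r where "r \<in> ?T" "y = r * d" using d(2) \<open>y \<in> insert x S\<close> by blast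
      then have "y = (r * t) * ?d" "r * t \<in> ?T" using e(4,6) dom_mult[OF dom_RX] by (metis mult.assoc, blast)
      then show ?thesis by blast
    qed
    ultimately show ?case by blast
  qed
  then obtain d where d: "d \<in> I" "\<And>s. s \<in> S \<Longrightarrow> \<exists>t\<in>?T. s = t * d" by blast
  have "d \<noteq> 0"
  proof
    assume "d = 0"
    then have "S \<subseteq> {0}" using d(2) by auto
    then have "I \<subseteq> {0}" unfolding I(4) by (intro span_least submodI) auto
    then show False using I(2) submod_zero[OF sI(1)] by blast
  qed
  have dinv: "inverse d \<in> QF ?T" using d(1) sI(2) sub_QF[OF dom_RX] by (intro QF_inverse[OF dom_RX]) blast
  have "inverse d \<in> colon ?T ?T S"
  proof (rule colonI[OF dinv])
    fix s assume "s \<in> S"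
    then obtain t where "t \<in> ?T" "s = t * d" using d(2) by blast
    then have "inverse d * s = t" using \<open>d \<noteq> 0\<close> by (simp add: field_simps)
    then show "inverse d * s \<in> ?T" using \<open>t \<in> ?T\<close> by simp
  qed
  then have "inverse d \<in> colon ?T ?T I" unfolding I(4) by (simp add: colon_span[OF dom_RX submod_self[OF dom_RX]])
  then have "d * inverse d \<in> prod_in ?T I (colon ?T ?T I)" by (intro prod_mem dom_RX d(1))
  then have "1 \<in> prod_in ?T I (colon ?T ?T I)" using \<open>d \<noteq> 0\<close> by simp
  moreover have "prod_in ?T I (colon ?T ?T I) \<subseteq> ?T"
  proof (rule prod_least[OF submod_self[OF dom_RX]])
    fix a b assume "a \<in> I" "b \<in> colon ?T ?T I"
    then have "b * a \<in> ?T" by (intro colonD(1))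
    then show "a * b \<in> ?T" by (simp add: mult.commute)
  qed
  ultimately show "prod_in ?T I (colon ?T ?T I) = ?T"
    by (intro ideal_eq_whole) (simp_all add: is_ideal_iff submod_prod[OF dom_RX])
qed

text \<open>Invertibility of the ideal generated by a and b gives a multiplier y with y a or y b
  outside \<open>ext R M\<close>: otherwise the whole product, and with it 1, would lie in that
  proper ideal.\<close>

lemma Prufer_RX_imp_PvMD:
  assumes Pr: "Prufer (RX R)"
  shows "PvMD R"
  unfolding PvMD_iff
proof (intro ballI impI)
  fix M a b assume M: "M \<in> t_Max R" and ab: "a \<in> R" "b \<in> R" "a \<noteq> 0" "b \<noteq> 0"
  let ?T = "RX R"
  let ?I = "span_in ?T {emb a, emb b}"
  have T: "{emb a, emb b} \<subseteq> ?T" using ab RX_emb by auto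
  have mem: "emb a \<in> ?I" "emb b \<in> ?I" using span_superset[OF dom_RX, of "{emb a, emb b}"] by auto
  have id: "is_ideal ?T ?I" unfolding is_ideal_iff
    using span_least[OF submod_self[OF dom_RX] T] submod_span[OF dom_RX] by blast
  have "fg_nonzero ?T ?I" unfolding fg_nonzero_def
    using T sub_QF[OF dom_RX] mem(1) ab(3) by (intro conjI exI[of _ "{emb a, emb b}"]) auto
  then have one: "1 \<in> prod_in ?T ?I (colon ?T ?T ?I)"
    using Pr id dom_one[OF dom_RX] unfolding Prufer_def by simp
  have sM: "submod ?T (ext R M)" by (rule submod_ext[OF t_MaxD(2)[OF M]])
  have one_nin: "1 \<notin> ext R M"
    using ideal_eq_whole[OF ideal_ext_t_Max[OF M]] ext_t_Max_proper[OF M] by blast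
  have "\<exists>y\<in>colon ?T ?T ?I. y * emb a \<notin> ext R M \<or> y * emb b \<notin> ext R M"
  proof (rule ccontr)
    assume neg: "\<not> ?thesis"
    have "prod_in ?T ?I (colon ?T ?T ?I) \<subseteq> ext R M"
    proof (rule prod_least[OF sM])
      fix i y assume i: "i \<in> ?I" and y: "y \<in> colon ?T ?T ?I"
      have "submod ?T {i. y * i \<in> ext R M}"
        using submod_zero[OF sM] submod_add[OF sM] submod_mult[OF sM]
        by (intro submodI) (simp_all add: distrib_left mult.left_commute[of y])
      then have "?I \<subseteq> {i. y * i \<in> ext R M}" using neg y by (intro span_least) auto
      then show "i * y \<in> ext R M" using i by (auto simp: mult.commute)
    qed
    then show False using one one_nin by blast
  qed
  then obtain y where y: "y \<in> colon ?T ?T ?I" "y * emb a \<notin> ext R M \<or> y * emb b \<notin> ext R M" by blast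
  have yT: "y * emb a \<in> ?T" "y * emb b \<in> ?T" using colonD(1)[OF y(1)] mem by blast+
  \<comment> \<open>Here y c has a numerator f outside M[X]. Cross-multiplying y c and y d gives d f
    g' = c f' g, and a coefficient of f g' outside M is a multiplier that carries d / c into
    R.\<close>
  have key: "\<exists>u\<in>R - M. u * (d / c) \<in> R"
    if c: "y * emb c \<in> ?T" "y * emb c \<notin> ext R M" "c \<noteq> 0" and d: "y * emb d \<in> ?T" for c d
  proof -
    obtain f g where f: "poly_over R f" "g \<in> N_t R" "y * emb c = to_fract f / to_fract g"
      using c(1) unfolding RX_eq_ext by (elim extE)
    obtain f' g' where f': "poly_over R f'" "g' \<in> N_t R" "y * emb d = to_fract f' / to_fract g'"
      using d unfolding RX_eq_ext by (elim extE)
    have fM: "\<not> poly_over M f" using c(2) extI[OF _ f(2)] unfolding f(3) by blast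
    have y0: "y \<noteq> 0" using c(2) submod_zero[OF sM] by auto
    have "emb d * (y * emb c) = emb c * (y * emb d)" by (simp add: mult_ac)
    then have "emb d * (to_fract f * to_fract g') = emb c * (to_fract f' * to_fract g)"
      unfolding f(3) f'(3) using N_tD(3)[OF f(2)] N_tD(3)[OF f'(2)] by (simp add: field_simps)
    then have "to_fract (smult d (f * g')) = to_fract (smult c (f' * g))" by (simp add: to_fract_smult)
    then have eq: "smult d (f * g') = smult c (f' * g)" unfolding to_fract_eq_iff .
    have "\<not> poly_over M (f * g')"
      using poly_over_prime[OF t_Max_prime[OF M] dom f(1) N_tD(1)[OF f'(2)]] fM N_tD(4)[OF f'(2) M] by blast
    then obtain i where i: "coeff (f * g') i \<notin> M" unfolding poly_over_def by blast
    have fg: "poly_over R (f * g')" "poly_over R (f' * g)"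
      using f f' N_tD(1) by (auto intro!: poly_over_mult[OF submod_self[OF dom]])
    have "d * coeff (f * g') i = c * coeff (f' * g) i" using arg_cong[OF eq, of "\<lambda>p. coeff p i"] by simp
    then have "coeff (f * g') i * (d / c) = coeff (f' * g) i" using c(3) by (simp add: field_simps)
    then show ?thesis using i fg unfolding poly_over_def by (intro bexI[of _ "coeff (f * g') i"]) auto
  qed
  from y(2) show "\<exists>u\<in>R - M. u * (a / b) \<in> R \<or> u * (b / a) \<in> R"
    using key[OF yT(1) _ ab(3) yT(2)] key[OF yT(2) _ ab(4) yT(1)] by blast
qed

lemma PvMD_iff_Prufer_RX: "PvMD R \<longleftrightarrow> Prufer (RX R)"
  using PvMD_imp_Prufer_RX Prufer_RX_imp_PvMD by blast

end

section \<open>The ideal correspondence for a PvMD\<close>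

definition contr :: "'a::field set \<Rightarrow> 'a poly fract set \<Rightarrow> 'a set" where
  "contr R J = {a \<in> R. emb a \<in> J}"

context proper_domain
begin

text \<open>Both inclusions are checks on generators: coefficients of f f' are sums of products from
  A and B, and constants give the other inclusion.\<close>

lemma prod_ext:
  assumes A: "submod R A" and B: "submod R B"
  shows "prod_in (RX R) (ext R A) (ext R B) = ext R (prod_in R A B)"
proof
  note sP = submod_prod[OF dom, of A B] and sT = submod_prod[OF dom_RX, of "ext R A" "ext R B"]
  show "prod_in (RX R) (ext R A) (ext R B) \<subseteq> ext R (prod_in R A B)"
  proof (rule prod_least[OF submod_ext[OF sP]])
    fix x y assume x: "x \<in> ext R A" and y: "y \<in> ext R B"
    obtain f g where f: "poly_over A f" "g \<in> N_t R" "x = to_fract f / to_fract g"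
      using x by (rule extE)
    obtain f' g' where f': "poly_over B f'" "g' \<in> N_t R" "y = to_fract f' / to_fract g'"
      using y by (rule extE)
    have "coeff (f * f') n \<in> prod_in R A B" for n
      unfolding coeff_mult using f(1) f'(1)
      by (intro submod_sum[OF sP] prod_mem dom) (simp_all add: poly_over_def)
    then have "poly_over (prod_in R A B) (f * f')" by (simp add: poly_over_def)
    from extI[OF this N_t_mult[OF f(2) f'(2)]] show "x * y \<in> ext R (prod_in R A B)"
      unfolding f(3) f'(3) by simp
  qed
  show "ext R (prod_in R A B) \<subseteq> prod_in (RX R) (ext R A) (ext R B)"
  proof (rule ext_least[OF sT])
    have "submod R {c. emb c \<in> prod_in (RX R) (ext R A) (ext R B)}"
      using submod_zero[OF sT] submod_add[OF sT] submod_mult[OF sT RX_emb]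
      by (intro submodI) simp_all
    then have "prod_in R A B \<subseteq> {c. emb c \<in> prod_in (RX R) (ext R A) (ext R B)}"
      by (rule prod_least) (simp add: prod_mem[OF dom_RX] emb_ext[OF A] emb_ext[OF B])
    then show "emb c \<in> prod_in (RX R) (ext R A) (ext R B)" if "c \<in> prod_in R A B" for c
      using that by blast
  qed
qed

lemma contr_ideal:
  assumes "is_ideal (RX R) J"
  shows "is_ideal R (contr R J)"
proof -
  have J: "submod (RX R) J" using assms by (simp add: is_ideal_iff)
  show ?thesis unfolding is_ideal_iff contr_def
    using submod_zero[OF J] submod_add[OF J] submod_mult[OF J RX_emb]
      dom_zero[OF dom] dom_add[OF dom] dom_mult[OF dom]
    by (intro conjI submodI) auto
qed

text \<open>At M some s in S is a local generator with denominator u, so u / s multiplies S into R.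
  For x in the v-closure x u / s is then in R, so u x lies in Rs and hence in I.\<close>

lemma PvMD_w_ideal_t_ideal:
  assumes V: "PvMD R" and I: "w_ideal R I"
  shows "t_ideal R I"
proof -
  note D = w_idealD[OF I]
  have "x \<in> I" if S: "finite S" "S \<subseteq> I" and x: "x \<in> v_op R S" for S x
  proof -
    obtain c where c: "c \<in> I" "c \<noteq> 0" using D(5) submod_zero[OF D(2)] by blast
    \<comment> \<open>The nonzero c makes the set nonempty and forces the local generator s to be
      nonzero.\<close>
    let ?S = "insert c S"
    have S': "finite ?S" "?S \<noteq> {}" "?S \<subseteq> I" "?S \<subseteq> QF R" using S c(1) D(4) by auto
    have x': "x \<in> v_op R ?S" using x v_op_mono[of S ?S R] by blast
    then have xQ: "x \<in> QF R" by (simp add: v_op_iff)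
    have "\<exists>u\<in>R - M. u * x \<in> I" if M: "M \<in> t_Max R" for M
    proof -
      obtain s u where s: "s \<in> ?S" "u \<in> R" "u \<notin> M" "\<And>a. a \<in> ?S \<Longrightarrow> \<exists>r\<in>R. u * a = r * s"
        using PvMD_local_generator[OF V M S'(1,2,4)] by blast
      have "u \<noteq> 0" by (rule t_Max_nonzero[OF M s(3)])
      then have s0: "s \<noteq> 0" using s(4)[of c] c(2) by auto
      have us: "u / s * a \<in> R" if a: "a \<in> ?S" for a
      proof -
        obtain r where "r \<in> R" "u * a = r * s" using s(4)[OF a] by blast
        then show ?thesis using s0 by simp
      qed
      have "u / s \<in> QF R" using s(1,2) S'(4) sub_QF[OF dom] by (intro QF_divide[OF dom]) auto
      then have "x * (u / s) \<in> R" using x' us unfolding v_op_iff by blast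
      then have "x * (u / s) * s \<in> I" using submod_mult[OF D(2) _ subsetD[OF S'(3) s(1)]] by blast
      then have "u * x \<in> I" using s0 by (simp add: mult.commute)
      then show ?thesis using s(2,3) by blast
    qed
    then have "x \<in> w_op R I" unfolding w_op_iff using xQ by blast
    then show "x \<in> I" using D(6) by simp
  qed
  then have "\<forall>S. finite S \<and> S \<subseteq> I \<longrightarrow> v_op R S \<subseteq> I" by blast
  then show ?thesis using D(1,5) unfolding t_ideal_iff[OF dom] by simp
qed

lemma PvMD_t_ideal_iff: "PvMD R \<Longrightarrow> t_ideal R I \<longleftrightarrow> w_ideal R I"
  using PvMD_w_ideal_t_ideal t_ideal_w_ideal by blast

text \<open>The w-closure is t-closed and the t-closure is w-closed, so each contains the
  other.\<close>

lemma PvMD_t_op_eq_w_op: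
  assumes V: "PvMD R" and I: "is_ideal R I" "I \<noteq> {0}"
  shows "t_op R I = w_op R I"
proof
  have I': "submod R I" "I \<subseteq> QF R" using I sub_QF[OF dom] by (auto simp: is_ideal_iff)
  have "t_op R (w_op R I) = w_op R I"
    using PvMD_w_ideal_t_ideal[OF V w_ideal_w_op[OF I]] by (simp add: t_ideal_def)
  then show "t_op R I \<subseteq> w_op R I" using t_op_mono[OF w_op_superset[OF I'(2)]] by blast
  have "w_op R (t_op R I) = t_op R I"
    using t_ideal_w_ideal[OF t_ideal_t_op[OF dom I]] by (simp add: w_ideal_def)
  then show "w_op R I \<subseteq> t_op R I" using w_op_mono[OF t_op_superset[OF dom I' I(2)]] by blast
qed

text \<open>Coefficients of a numerator in J are T-multiples of that numerator, so they lie in J as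
  well.\<close>

lemma PvMD_ext_contr:
  assumes V: "PvMD R" and J: "is_ideal (RX R) J"
  shows "ext R (contr R J) = J"
proof
  have sJ: "submod (RX R) J" "J \<subseteq> RX R" using J by (simp_all add: is_ideal_iff)
  show "ext R (contr R J) \<subseteq> J" by (rule ext_least[OF sJ(1)]) (simp add: contr_def)
  show "J \<subseteq> ext R (contr R J)"
  proof
    fix x assume x: "x \<in> J"
    then have "x \<in> ext R R" using sJ(2) unfolding RX_eq_ext by blast
    then obtain f g where f: "poly_over R f" "g \<in> N_t R" "x = to_fract f / to_fract g" by (rule extE)
    have "to_fract g * x \<in> J" by (rule submod_mult[OF sJ(1) RX_poly[OF N_tD(1)[OF f(2)]] x])
    then have fJ: "to_fract f \<in> J" using f(3) N_tD(3)[OF f(2)] by simp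
    have "coeff f i \<in> contr R J" for i
    proof -
      obtain t where "t \<in> RX R" "emb (coeff f i) = t * to_fract f"
        using PvMD_coeff_multiple[OF V poly_over_mono[OF sub_QF[OF dom] f(1)]] by blast
      then have "emb (coeff f i) \<in> J" using submod_mult[OF sJ(1) _ fJ] by simp
      then show ?thesis using f(1) by (simp add: contr_def poly_over_def)
    qed
    then have "poly_over (contr R J) f" by (simp add: poly_over_def)
    then show "x \<in> ext R (contr R J)" unfolding f(3) by (rule extI[OF _ f(2)])
  qed
qed

lemma PvMD_contr_w_ideal:
  assumes V: "PvMD R" and J: "is_ideal (RX R) J" "J \<noteq> {0}"
  shows "w_ideal R (contr R J)"
proof -
  have I: "is_ideal R (contr R J)" by (rule contr_ideal[OF J(1)])
  then have I': "submod R (contr R J)" "contr R J \<subseteq> QF R"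
    using sub_QF[OF dom] by (auto simp: is_ideal_iff)
  have "w_op R (contr R J) \<subseteq> contr R J"
  proof
    fix x assume "x \<in> w_op R (contr R J)"
    then have "emb x \<in> J" using emb_ext_iff[OF I'] PvMD_ext_contr[OF V J(1)] by simp
    moreover from this have "x \<in> R" using J(1) emb_RX_iff by (auto simp: is_ideal_iff)
    ultimately show "x \<in> contr R J" by (simp add: contr_def)
  qed
  moreover have "contr R J \<noteq> {0}"
  proof
    assume 0: "contr R J = {0}"
    have "ext R {0} \<subseteq> {0}" by (rule ext_least) (auto intro: submodI)
    then have "J \<subseteq> {0}" using PvMD_ext_contr[OF V J(1)] 0 by simp
    then show False using J submod_zero by (auto simp: is_ideal_iff)
  qed
  ultimately show ?thesis using I w_op_superset[OF I'(2)] unfolding w_ideal_def by blast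
qed

text \<open>Reduces a statement about all nonzero ideals of T to one about w-ideals of R, so that
  primes, divisoriality and stability each need only a pointwise equivalence.\<close>

lemma PvMD_all_ideals:
  assumes V: "PvMD R"
  shows "(\<forall>J. is_ideal (RX R) J \<and> J \<noteq> {0} \<longrightarrow> Q J) \<longleftrightarrow> (\<forall>I. w_ideal R I \<longrightarrow> Q (ext R I))"
proof (intro iffI allI impI)
  fix I assume "\<forall>J. is_ideal (RX R) J \<and> J \<noteq> {0} \<longrightarrow> Q J" and I: "w_ideal R I"
  then show "Q (ext R I)"
    using ideal_ext[OF w_idealD(1)[OF I]] ext_nonzero[OF w_idealD(2,5)[OF I]] by blast
next
  fix J assume a: "\<forall>I. w_ideal R I \<longrightarrow> Q (ext R I)" and J: "is_ideal (RX R) J \<and> J \<noteq> {0}"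
  then have "Q (ext R (contr R J))" using PvMD_contr_w_ideal[OF V] by blast
  then show "Q J" using PvMD_ext_contr[OF V] J by simp
qed

text \<open>Constants transfer primeness down to R. Upward, I lies in some maximal t-ideal, so
  \<open>ext_prime_iff\<close> reduces the question to numerators, where Gauss's lemma
  applies.\<close>

lemma PvMD_prime_ext_iff:
  assumes V: "PvMD R" and I: "w_ideal R I"
  shows "prime_ideal (RX R) (ext R I) \<longleftrightarrow> prime_ideal R I"
proof
  assume P: "prime_ideal (RX R) (ext R I)"
  have "I \<noteq> R" using P unfolding prime_ideal_def RX_eq_ext by blast
  moreover have "a \<in> I \<or> b \<in> I" if "a \<in> R" "b \<in> R" "a * b \<in> I" for a b
  proof -
    have "emb a * emb b \<in> ext R I" using that(3) emb_ext_w_ideal[OF I, of "a * b"] by simp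
    then have "emb a \<in> ext R I \<or> emb b \<in> ext R I"
      using P RX_emb that(1,2) unfolding prime_ideal_def by blast
    then show ?thesis unfolding emb_ext_w_ideal[OF I] .
  qed
  ultimately show "prime_ideal R I" using w_idealD(1)[OF I] unfolding prime_ideal_def by blast
next
  assume P: "prime_ideal R I"
  have "I \<noteq> R" using P by (simp add: prime_ideal_def)
  from t_Max_exists[OF PvMD_w_ideal_t_ideal[OF V I] this] obtain M where M: "M \<in> t_Max R" "I \<subseteq> M" .
  have "1 \<notin> ext R I" using emb_ext_w_ideal[OF I, of 1] M t_MaxD(4) by auto
  then have "ext R I \<noteq> RX R" using dom_one[OF dom_RX] by blast
  moreover have "x \<in> ext R I \<or> y \<in> ext R I" if xy: "x \<in> RX R" "y \<in> RX R" "x * y \<in> ext R I" for x y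
  proof -
    obtain f g where f: "poly_over R f" "g \<in> N_t R" "x = to_fract f / to_fract g"
      using xy(1) unfolding RX_eq_ext by (elim extE)
    obtain f' g' where f': "poly_over R f'" "g' \<in> N_t R" "y = to_fract f' / to_fract g'"
      using xy(2) unfolding RX_eq_ext by (elim extE)
    have "to_fract (f * f') / to_fract (g * g') \<in> ext R I" using xy(3) f(3) f'(3) by simp
    moreover have "poly_over R (f * f')" by (rule poly_over_mult[OF submod_self[OF dom] f(1) f'(1)])
    ultimately have "poly_over I (f * f')"
      using ext_prime_iff[OF P M _ N_t_mult[OF f(2) f'(2)]] by blast
    then have "poly_over I f \<or> poly_over I f'" by (rule poly_over_prime[OF P dom f(1) f'(1)])
    then show ?thesis unfolding f(3) f'(3) using extI f(2) f'(2) by blast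
  qed
  ultimately show "prime_ideal (RX R) (ext R I)"
    using ideal_ext[OF w_idealD(1)[OF I]] unfolding prime_ideal_def by blast
qed

lemma PvMD_all_primes:
  assumes V: "PvMD R"
  shows "(\<forall>P. prime_ideal (RX R) P \<and> P \<noteq> {0} \<longrightarrow> Q P) \<longleftrightarrow> (\<forall>P. t_prime R P \<longrightarrow> Q (ext R P))"
proof -
  have "(\<forall>P. prime_ideal (RX R) P \<and> P \<noteq> {0} \<longrightarrow> Q P) \<longleftrightarrow>
      (\<forall>P. is_ideal (RX R) P \<and> P \<noteq> {0} \<longrightarrow> (prime_ideal (RX R) P \<longrightarrow> Q P))"
    unfolding prime_ideal_def by blast
  also have "\<dots> \<longleftrightarrow> (\<forall>I. w_ideal R I \<longrightarrow> (prime_ideal R I \<longrightarrow> Q (ext R I)))"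
    unfolding PvMD_all_ideals[OF V] using PvMD_prime_ext_iff[OF V] by blast
  also have "\<dots> \<longleftrightarrow> (\<forall>P. t_prime R P \<longrightarrow> Q (ext R P))"
    unfolding t_prime_def PvMD_t_ideal_iff[OF V] by blast
  finally show ?thesis .
qed

lemma PvMD_weakly_Matlis_iff:
  assumes V: "PvMD R"
  shows "weakly_Matlis R \<longleftrightarrow> h_local (RX R)"
proof -
  have key: "(\<exists>!M. M \<in> t_Max R \<and> P \<subseteq> M) \<longleftrightarrow> (\<exists>!N. N \<in> Max_ideals (RX R) \<and> ext R P \<subseteq> N)"
    if P: "t_prime R P" for P
  proof -
    have w: "w_ideal R P" using P t_ideal_w_ideal by (simp add: t_prime_def)
    have sub: "ext R P \<subseteq> ext R M \<longleftrightarrow> P \<subseteq> M" if "M \<in> t_Max R" for M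
      by (rule ext_subset_iff[OF w t_Max_w_ideal[OF that]])
    have inj: "ext R M = ext R N \<longleftrightarrow> M = N" if "M \<in> t_Max R" "N \<in> t_Max R" for M N
      using inj_on_ext_t_Max that by (auto dest: inj_onD)
    show ?thesis unfolding Max_ideals_RX
    proof
      assume "\<exists>!M. M \<in> t_Max R \<and> P \<subseteq> M"
      then obtain M where M: "M \<in> t_Max R \<and> P \<subseteq> M" "\<forall>M'. M' \<in> t_Max R \<and> P \<subseteq> M' \<longrightarrow> M' = M" by (rule ex1E)
      show "\<exists>!N. N \<in> ext R ` t_Max R \<and> ext R P \<subseteq> N"
      proof (rule ex1I[of _ "ext R M"])
        show "ext R M \<in> ext R ` t_Max R \<and> ext R P \<subseteq> ext R M" using M(1) sub[of M] by simp
        fix N assume N: "N \<in> ext R ` t_Max R \<and> ext R P \<subseteq> N"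
        then obtain M' where M': "M' \<in> t_Max R" "N = ext R M'" by blast
        then have "M' = M" using M(2) N sub[of M'] by simp
        then show "N = ext R M" using M'(2) by simp
      qed
    next
      assume "\<exists>!N. N \<in> ext R ` t_Max R \<and> ext R P \<subseteq> N"
      then obtain N where N: "N \<in> ext R ` t_Max R \<and> ext R P \<subseteq> N"
        "\<forall>N'. N' \<in> ext R ` t_Max R \<and> ext R P \<subseteq> N' \<longrightarrow> N' = N" by (rule ex1E)
      then obtain M where M: "M \<in> t_Max R" "N = ext R M" by blast
      show "\<exists>!M. M \<in> t_Max R \<and> P \<subseteq> M"
      proof (rule ex1I[of _ M])
        show "M \<in> t_Max R \<and> P \<subseteq> M" using M N(1) sub[of M] by simp
        fix M' assume M': "M' \<in> t_Max R \<and> P \<subseteq> M'"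
        then have "ext R M' = ext R M" using N(2) sub[of M'] M(2) by simp
        then show "M' = M" using inj[of M' M] M' M(1) by simp
      qed
    qed
  qed
  show ?thesis
    unfolding weakly_Matlis_def h_local_def PvMD_all_primes[OF V] finite_character_iff
    by (intro conj_cong iff_allI imp_cong refl key)
qed

text \<open>The square of P extends to the square of \<open>ext R P\<close>, and extensions coincide
  exactly when the w-closures do; over a PvMD the w-closure of the square is its t-closure.\<close>

lemma PvMD_strongly_discrete_iff:
  assumes V: "PvMD R"
  shows "strongly_discrete_PvMD R \<longleftrightarrow> strongly_discrete_Prufer (RX R)"
proof -
  have key: "t_op R (prod_in R P P) = P \<longleftrightarrow> prod_in (RX R) (ext R P) (ext R P) = ext R P"
    if P: "t_prime R P" for P
  proof -
    have w: "w_ideal R P" using P t_ideal_w_ideal by (simp add: t_prime_def)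
    note D = w_idealD[OF w]
    let ?Q = "prod_in R P P"
    have QP: "?Q \<subseteq> P" by (rule prod_least[OF D(2)]) (use D(3) submod_mult[OF D(2)] in blast)
    have "0 \<in> P" by (rule submod_zero[OF D(2)])
    then obtain c where c: "c \<in> P" "c \<noteq> 0" using D(5) by blast
    \<comment> \<open>The comparison of t-closure and w-closure is for nonzero ideals.\<close>
    have "c * c \<in> ?Q" by (rule prod_mem[OF dom c(1) c(1)])
    moreover have "c * c \<noteq> 0" using c(2) by simp
    ultimately have "?Q \<noteq> {0}" by (metis singletonD)
    moreover have Q: "submod R ?Q" "?Q \<subseteq> QF R" by (rule submod_prod[OF dom], rule subset_trans[OF QP D(4)])
    moreover have "is_ideal R ?Q" unfolding is_ideal_iff using Q(1) QP D(3) by simp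
    ultimately have "t_op R ?Q = w_op R ?Q" by (intro PvMD_t_op_eq_w_op[OF V])
    then show ?thesis unfolding prod_ext[OF D(2) D(2)] ext_eq_iff[OF Q(1,2) D(2,4)] D(6) by simp
  qed
  show ?thesis
    unfolding strongly_discrete_PvMD_def strongly_discrete_Prufer_def PvMD_all_primes[OF V]
      PvMD_iff_Prufer_RX
    by (intro conj_cong iff_allI imp_cong refl arg_cong[of _ _ Not] key)
qed

text \<open>For the upward direction, each coefficient of f equals (t g) x for some t in T, so its
  n-th power is a T-multiple of \<open>x ^ n\<close> and contracts to I. This avoids expanding
  powers of f.\<close>

lemma PvMD_radical_ext_iff:
  assumes V: "PvMD R" and I: "w_ideal R I"
  shows "radical_in (RX R) (ext R I) \<longleftrightarrow> radical_in R I"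
proof
  assume rad: "radical_in (RX R) (ext R I)"
  show "radical_in R I" unfolding radical_in_def
  proof (intro ballI allI impI)
    fix x and n :: nat assume x: "x \<in> R" "x ^ n \<in> I"
    then have "emb x ^ n \<in> ext R I" using emb_ext_w_ideal[OF I, of "x ^ n"] by simp
    then have "emb x \<in> ext R I" using rad RX_emb[OF x(1)] unfolding radical_in_def by blast
    then show "x \<in> I" unfolding emb_ext_w_ideal[OF I] .
  qed
next
  assume rad: "radical_in R I"
  have E: "submod (RX R) (ext R I)" by (rule submod_ext[OF w_idealD(2)[OF I]])
  show "radical_in (RX R) (ext R I)" unfolding radical_in_def
  proof (intro ballI allI impI)
    fix x and n :: nat assume x: "x \<in> RX R" "x ^ n \<in> ext R I"
    obtain f g where f: "poly_over R f" "g \<in> N_t R" "x = to_fract f / to_fract g"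
      using x(1) unfolding RX_eq_ext by (elim extE)
    have fg: "to_fract f = to_fract g * x" using f(3) N_tD(3)[OF f(2)] by simp
    have "coeff f i \<in> I" for i
    proof -
      obtain t where t: "t \<in> RX R" "emb (coeff f i) = t * to_fract f"
        using PvMD_coeff_multiple[OF V poly_over_mono[OF sub_QF[OF dom] f(1)]] by blast
      have "emb (coeff f i ^ n) = (t * to_fract g) ^ n * x ^ n"
        unfolding emb_power t(2) fg by (simp add: power_mult_distrib mult.assoc)
      moreover have "(t * to_fract g) ^ n \<in> RX R"
        by (intro dom_power[OF dom_RX] dom_mult[OF dom_RX] t(1) RX_poly N_tD(1)[OF f(2)])
      ultimately have "emb (coeff f i ^ n) \<in> ext R I" using submod_mult[OF E _ x(2)] by simp
      then have "coeff f i ^ n \<in> I" unfolding emb_ext_w_ideal[OF I] .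
      moreover have "coeff f i \<in> R" using f(1) by (simp add: poly_over_def)
      ultimately show ?thesis using rad unfolding radical_in_def by blast
    qed
    then have "poly_over I f" by (simp add: poly_over_def)
    then show "x \<in> ext R I" unfolding f(3) by (rule extI[OF _ f(2)])
  qed
qed

lemma PvMD_acc_radical_iff:
  assumes V: "PvMD R"
  shows "acc_radical_t R \<longleftrightarrow> acc_radical (RX R)"
proof
  assume acc: "acc_radical_t R"
  show "acc_radical (RX R)" unfolding acc_radical_def
  proof
    assume "\<exists>F. \<forall>n::nat. is_ideal (RX R) (F n) \<and> radical_in (RX R) (F n) \<and> F n \<subset> F (Suc n)"
    then obtain F where F: "\<And>n::nat. is_ideal (RX R) (F n)" "\<And>n. radical_in (RX R) (F n)"
      "\<And>n. F n \<subset> F (Suc n)" by blast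
    \<comment> \<open>The shift drops \<open>F 0\<close>, which may be the zero ideal and then
      contracts to no t-ideal; every later member strictly contains another ideal and is
      nonzero.\<close>
    let ?G = "\<lambda>n. contr R (F (Suc n))"
    have G: "w_ideal R (?G n)" "ext R (?G n) = F (Suc n)" for n
    proof -
      have "F (Suc n) \<noteq> {0}"
      proof
        assume "F (Suc n) = {0}"
        then have "F n \<subset> {0}" using F(3)[of n] by simp
        moreover have "0 \<in> F n" using F(1)[of n] by (simp add: is_ideal_def)
        ultimately show False by auto
      qed
      then show "w_ideal R (?G n)" by (rule PvMD_contr_w_ideal[OF V F(1)])
      show "ext R (?G n) = F (Suc n)" by (rule PvMD_ext_contr[OF V F(1)])
    qed
    have "?G n \<subset> ?G (Suc n)" for n
    proof -
      have "ext R (?G n) \<subset> ext R (?G (Suc n))" unfolding G(2) by (rule F(3))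
      then show ?thesis
        using ext_subset_iff[OF G(1)[of n] G(1)[of "Suc n"]]
          ext_subset_iff[OF G(1)[of "Suc n"] G(1)[of n]] by (simp only: less_le_not_le simp_thms)
    qed
    moreover have "t_ideal R (?G n)" "radical_in R (?G n)" for n
      using PvMD_w_ideal_t_ideal[OF V G(1)] PvMD_radical_ext_iff[OF V G(1)[of n]] F(2)[of "Suc n"]
      unfolding G(2) by simp_all
    ultimately show False using acc unfolding acc_radical_t_def
      by (elim notE) (intro exI[of _ ?G] allI conjI)
  qed
next
  assume acc: "acc_radical (RX R)"
  show "acc_radical_t R" unfolding acc_radical_t_def
  proof
    assume "\<exists>F. \<forall>n::nat. t_ideal R (F n) \<and> radical_in R (F n) \<and> F n \<subset> F (Suc n)"
    then obtain F where F: "\<And>n::nat. t_ideal R (F n)" "\<And>n. radical_in R (F n)"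
      "\<And>n. F n \<subset> F (Suc n)" by blast
    have w: "w_ideal R (F n)" for n by (rule t_ideal_w_ideal[OF F(1)])
    have "ext R (F n) \<subset> ext R (F (Suc n))" for n
      using ext_subset_iff[OF w[of n] w[of "Suc n"]] ext_subset_iff[OF w[of "Suc n"] w[of n]] F(3)[of n]
      by (simp only: less_le_not_le simp_thms)
    moreover have "is_ideal (RX R) (ext R (F n))" "radical_in (RX R) (ext R (F n))" for n
      using ideal_ext[OF w_idealD(1)[OF w]] PvMD_radical_ext_iff[OF V w[of n]] F(2)[of n] by simp_all
    ultimately show False using acc unfolding acc_radical_def
      by (elim notE) (intro exI[of _ "\<lambda>n. ext R (F n)"] allI conjI)
  qed
qed

text \<open>The extension of the colon lies in the colon of the extensions by
  \<open>prod_ext\<close>. Conversely a nonzero b in B turns y into a fraction h / g with h over the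
  quotient field; each coefficient of h is a T-multiple of y, so it carries B into
  \<open>ext R A\<close>, and that contracts to A because A is w-closed.\<close>

lemma PvMD_colon_ext:
  assumes V: "PvMD R" and A: "submod R A" "A \<subseteq> QF R" "w_op R A = A"
    and B: "submod R B" "B \<subseteq> QF R" "B \<noteq> {0}"
  shows "colon (RX R) (ext R A) (ext R B) = ext R (colon R A B)"
proof
  note sC = submod_colon[OF dom A(1), of B]
  show "ext R (colon R A B) \<subseteq> colon (RX R) (ext R A) (ext R B)"
  proof
    fix x assume x: "x \<in> ext R (colon R A B)"
    have "colon R A B \<subseteq> QF R" by (auto simp: colon_def)
    then have xQ: "x \<in> QF (RX R)" using ext_sub_QF x by blast
    have "prod_in R (colon R A B) B \<subseteq> A" by (rule prod_least[OF A(1)]) (rule colonD(1))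
    then have "prod_in (RX R) (ext R (colon R A B)) (ext R B) \<subseteq> ext R A"
      unfolding prod_ext[OF sC B(1)] by (rule ext_mono)
    then show "x \<in> colon (RX R) (ext R A) (ext R B)"
      using prod_mem[OF dom_RX x] by (intro colonI[OF xQ]) blast
  qed
  show "colon (RX R) (ext R A) (ext R B) \<subseteq> ext R (colon R A B)"
  proof
    fix y assume y: "y \<in> colon (RX R) (ext R A) (ext R B)"
    obtain b where b: "b \<in> B" "b \<noteq> 0" using B(3) submod_zero[OF B(1)] by blast
    have yB: "y * emb c \<in> ext R A" if "c \<in> B" for c
      using colonD(1)[OF y emb_ext[OF B(1) that]] .
    obtain f g where f: "poly_over A f" "g \<in> N_t R" "y * emb b = to_fract f / to_fract g"
      using yB[OF b(1)] by (rule extE)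
    define h where "h = smult (inverse b) f"
    have yh: "y = to_fract h / to_fract g"
    proof -
      have "y = y * emb b * emb (inverse b)" using b(2) by simp
      also have "\<dots> = to_fract h / to_fract g" unfolding f(3) h_def to_fract_smult by simp
      finally show ?thesis .
    qed
    have bQ: "inverse b \<in> QF R" using b(1) B(2) by (intro QF_inverse[OF dom]) blast
    have hQ: "coeff h i \<in> QF R" for i
    proof -
      have "coeff f i \<in> QF R" using f(1) A(2) unfolding poly_over_def by blast
      then show ?thesis unfolding h_def coeff_smult by (rule dom_mult[OF dom_in_QF[OF dom] bQ])
    qed
    have "coeff h i \<in> colon R A B" for i
    proof (rule colonI[OF hQ])
      fix c assume c: "c \<in> B"
      have "poly_over (QF R) h" using hQ by (simp add: poly_over_def)
      from PvMD_coeff_multiple[OF V this]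
      obtain t where t: "t \<in> RX R" "emb (coeff h i) = t * to_fract h" by blast
      have "to_fract h = to_fract g * y" using yh N_tD(3)[OF f(2)] by simp
      then have eq: "emb (coeff h i * c) = (t * to_fract g) * (y * emb c)" using t(2) by (simp add: mult_ac)
      have "t * to_fract g \<in> RX R" by (intro dom_mult[OF dom_RX] t(1) RX_poly N_tD(1)[OF f(2)])
      then have "emb (coeff h i * c) \<in> ext R A"
        unfolding eq by (rule submod_mult[OF submod_ext[OF A(1)] _ yB[OF c]])
      then show "coeff h i * c \<in> A" unfolding emb_ext_iff[OF A(1,2)] A(3) .
    qed
    then have "poly_over (colon R A B) h" by (simp add: poly_over_def)
    then show "y \<in> ext R (colon R A B)" unfolding yh by (rule extI[OF _ f(2)])
  qed
qed

lemma w_op_colon: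
  assumes A: "submod R A" "A \<subseteq> QF R" "w_op R A = A" and B: "B \<subseteq> QF R"
  shows "w_op R (colon R A B) = colon R A B"
proof
  show "colon R A B \<subseteq> w_op R (colon R A B)" by (rule w_op_superset) (auto simp: colon_def)
  show "w_op R (colon R A B) \<subseteq> colon R A B"
  proof
    fix x assume x: "x \<in> w_op R (colon R A B)"
    then have xQ: "x \<in> QF R" by (simp add: w_op_iff)
    show "x \<in> colon R A B"
    proof (rule colonI[OF xQ])
      fix b assume b: "b \<in> B"
      have "x * b \<in> w_op R A" unfolding w_op_iff
      proof (intro conjI ballI)
        show "x * b \<in> QF R" using xQ b B by (intro dom_mult[OF dom_in_QF[OF dom]]) auto
        fix M assume "M \<in> t_Max R"
        then obtain u where u: "u \<in> R - M" "u * x \<in> colon R A B" using x unfolding w_op_iff by blast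
        have "u * x * b \<in> A" by (rule colonD(1)[OF u(2) b])
        then show "\<exists>u\<in>R - M. u * (x * b) \<in> A" using u(1) by (intro bexI[of _ u]) (simp_all add: mult.assoc)
      qed
      then show "x * b \<in> A" using A(3) by simp
    qed
  qed
qed

lemma colon_self_facts:
  assumes I: "w_ideal R I"
  shows "submod R (colon R R I)" "colon R R I \<subseteq> QF R" "colon R R I \<noteq> {0}" "w_op R (colon R R I) = colon R R I"
    and "submod R (Eo R I)" "Eo R I \<subseteq> QF R" "w_op R (Eo R I) = Eo R I"
proof -
  note D = w_idealD[OF I]
  show "submod R (colon R R I)" "submod R (Eo R I)"
    unfolding Eo_def by (intro submod_colon[OF dom] submod_self dom D)+
  show "colon R R I \<subseteq> QF R" "Eo R I \<subseteq> QF R" unfolding Eo_def colon_def by blast+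
  have "1 \<in> colon R R I" using dom_one[OF dom] sub_QF[OF dom] D(3) by (intro colonI) auto
  then show "colon R R I \<noteq> {0}" by auto
  show "w_op R (colon R R I) = colon R R I"
    by (rule w_op_colon[OF submod_self[OF dom] sub_QF[OF dom] w_op_R D(4)])
  show "w_op R (Eo R I) = Eo R I" unfolding Eo_def by (rule w_op_colon[OF D(2,4,6,4)])
qed

text \<open>The v-closure is a double colon, and \<open>PvMD_colon_ext\<close> applies first to I
  and then to \<open>colon R R I\<close>.\<close>

lemma PvMD_divisorial_iff:
  assumes V: "PvMD R"
  shows "w_divisorial R \<longleftrightarrow> divisorial (RX R)"
proof -
  have key: "v_op R I = I \<longleftrightarrow> v_op (RX R) (ext R I) = ext R I" if I: "w_ideal R I" for I
  proof -
    note D = w_idealD[OF I] and C = colon_self_facts[OF I]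
    have "colon (RX R) (RX R) (ext R I) = ext R (colon R R I)"
      using PvMD_colon_ext[OF V submod_self[OF dom] sub_QF[OF dom] w_op_R D(2,4,5)] by (simp add: RX_eq_ext)
    then have "v_op (RX R) (ext R I) = ext R (v_op R I)"
      unfolding v_op_def
      using PvMD_colon_ext[OF V submod_self[OF dom] sub_QF[OF dom] w_op_R C(1-3)] by (simp add: RX_eq_ext)
    moreover have "w_op R (v_op R I) = v_op R I"
      unfolding v_op_def by (rule w_op_colon[OF submod_self[OF dom] sub_QF[OF dom] w_op_R C(2)])
    moreover have "v_op R I \<subseteq> QF R" by (auto simp: v_op_iff)
    ultimately show ?thesis using ext_eq_iff[OF submod_v_op[OF dom] _ D(2,4)] D(6) by simp
  qed
  show ?thesis unfolding w_divisorial_def divisorial_def PvMD_all_ideals[OF V]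
    by (intro iff_allI imp_cong refl key)
qed

text \<open>The ring \<open>Eo R I\<close>, the colon and the product all commute with extension.
  Equality of extensions is equality of w-closures, and \<open>Eo R I\<close> is w-closed.\<close>

lemma PvMD_stable_iff:
  assumes V: "PvMD R"
  shows "w_stable R \<longleftrightarrow> stable (RX R)"
proof -
  have key: "w_op R (prod_in R I (colon R (Eo R I) I)) = Eo R I \<longleftrightarrow>
      prod_in (RX R) (ext R I) (colon (RX R) (Eo (RX R) (ext R I)) (ext R I)) = Eo (RX R) (ext R I)"
    if I: "w_ideal R I" for I
  proof -
    note D = w_idealD[OF I] and C = colon_self_facts[OF I]
    let ?c = "colon R (Eo R I) I"
    have c: "submod R ?c" by (rule submod_colon[OF dom C(5)])
    have "Eo (RX R) (ext R I) = ext R (Eo R I)"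
      unfolding Eo_def by (rule PvMD_colon_ext[OF V D(2,4,6) D(2,4,5)])
    moreover have "colon (RX R) (ext R (Eo R I)) (ext R I) = ext R ?c"
      by (rule PvMD_colon_ext[OF V C(5-7) D(2,4,5)])
    moreover have "prod_in R I ?c \<subseteq> QF R"
    proof (rule prod_least[OF submod_QF[OF dom]])
      fix a b assume "a \<in> I" "b \<in> ?c"
      then show "a * b \<in> QF R" using D(4) by (intro dom_mult[OF dom_in_QF[OF dom]]) (auto simp: colon_def)
    qed
    ultimately show ?thesis
      using ext_eq_iff[OF submod_prod[OF dom] _ C(5,6)] prod_ext[OF D(2) c] C(7) by simp
  qed
  show ?thesis unfolding w_stable_def stable_def PvMD_all_ideals[OF V]
    by (intro iff_allI imp_cong refl key)
qed

end

section \<open>Integrally closed domains\<close>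

text \<open>A determinant-free form of the determinant trick: eliminating one unknown after the other
  keeps the diagonal entries monic of a common degree that exceeds all off-diagonal degrees.\<close>

lemma elimination_integral:
  fixes a :: "'i \<Rightarrow> 'i \<Rightarrow> 'a::field poly" and v :: "'i \<Rightarrow> 'a"
  assumes D: "dom_in D" and "finite I" "\<exists>i\<in>I. v i \<noteq> 0"
    and "\<And>i. i \<in> I \<Longrightarrow> (\<Sum>j\<in>I. poly (a i j) x * v j) = 0"
    and "\<And>i j. i \<in> I \<Longrightarrow> j \<in> I \<Longrightarrow> poly_over D (a i j)"
    and "\<And>i. i \<in> I \<Longrightarrow> lead_coeff (a i i) = 1 \<and> degree (a i i) = k"
    and "\<And>i j. i \<in> I \<Longrightarrow> j \<in> I \<Longrightarrow> i \<noteq> j \<Longrightarrow> degree (a i j) < k"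
  shows "\<exists>p. poly_over D p \<and> lead_coeff p = 1 \<and> poly p x = 0"
  using assms(2-)
proof (induction I arbitrary: a k rule: finite_induct)
  case empty
  then show ?case by simp
next
  case (insert n I)
  have sum: "poly (a i n) x * v n + (\<Sum>j\<in>I. poly (a i j) x * v j) = 0" if "i \<in> insert n I" for i
    using insert.prems(2)[OF that] insert.hyps by simp
  have nn: "poly_over D (a n n)" "lead_coeff (a n n) = 1" "degree (a n n) = k"
    using insert.prems(3,4) by auto
  show ?case
  proof (cases "\<exists>i\<in>I. v i \<noteq> 0")
    case False
    \<comment> \<open>All other unknowns vanish, so row n alone makes x a root of the monic
      \<open>a n n\<close>.\<close>
    then have "v n \<noteq> 0" using insert.prems(1) by auto
    moreover have "(\<Sum>j\<in>I. poly (a n j) x * v j) = 0" using False by (intro sum.neutral) auto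
    ultimately have "poly (a n n) x = 0" using sum[of n] by simp
    then show ?thesis using nn by blast
  next
    case True
    \<comment> \<open>Cross-multiplying rows n and i cancels \<open>v n\<close> without division; k
      doubles, since only a product of two diagonal entries reaches degree k + k.\<close>
    define b where "b i j = a n n * a i j - a i n * a n j" for i j
    have sub: "submod D D" by (rule submod_self[OF D])
    have ov: "poly_over D (b i j)" if "i \<in> I" "j \<in> I" for i j
    proof -
      have "poly_over D (a n n * a i j)" "poly_over D (a i n * a n j)"
        using that insert.prems(3) by (auto intro!: poly_over_mult[OF sub])
      then show ?thesis unfolding b_def poly_over_def coeff_diff by (auto intro: dom_diff[OF D])
    qed
    have nI: "i \<noteq> n" if "i \<in> I" for i using that insert.hyps by blast
    have deg2: "degree (a i n * a n j) < k + k" if "i \<in> I" "j \<in> I" for i j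
    proof -
      have "degree (a i n) < k" "degree (a n j) < k" using insert.prems(5) that nI by blast+
      then show ?thesis using degree_mult_le[of "a i n" "a n j"] by linarith
    qed
    have diag: "lead_coeff (b i i) = 1 \<and> degree (b i i) = k + k" if i: "i \<in> I" for i
    proof -
      have ii: "lead_coeff (a i i) = 1" "degree (a i i) = k" using insert.prems(4) i by auto
      have nz: "a n n \<noteq> 0" "a i i \<noteq> 0" using nn(2) ii(1) by auto
      have d: "degree (a n n * a i i) = k + k" using nz nn ii by (simp add: degree_mult_eq)
      have l: "coeff (a n n * a i i) (k + k) = 1"
        using nn ii lead_coeff_mult[of "a n n" "a i i"] d by simp
      have c: "coeff (b i i) (k + k) = 1"
        unfolding b_def coeff_diff l using coeff_eq_0[OF deg2[OF i i]] by simp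
      have "degree (b i i) \<le> k + k"
        unfolding b_def using d deg2[OF i i] by (intro degree_diff_le) auto
      moreover have "k + k \<le> degree (b i i)" using c by (intro le_degree) simp
      ultimately have "degree (b i i) = k + k" by simp
      then show ?thesis using c by simp
    qed
    have off: "degree (b i j) < k + k" if ij: "i \<in> I" "j \<in> I" "i \<noteq> j" for i j
    proof -
      have "degree (a i j) < k" using insert.prems(5) ij by blast
      then have "degree (a n n * a i j) < k + k"
        using degree_mult_le[of "a n n" "a i j"] nn(3) by linarith
      then show ?thesis unfolding b_def using deg2[OF ij(1,2)] by (rule degree_diff_less)
    qed
    have zero: "(\<Sum>j\<in>I. poly (b i j) x * v j) = 0" if i: "i \<in> I" for i
    proof -
      have "(\<Sum>j\<in>I. poly (b i j) x * v j) =
          poly (a n n) x * (\<Sum>j\<in>I. poly (a i j) x * v j) - poly (a i n) x * (\<Sum>j\<in>I. poly (a n j) x * v j)"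
        by (simp add: b_def algebra_simps sum_subtractf sum_distrib_left)
      also have "(\<Sum>j\<in>I. poly (a i j) x * v j) = - (poly (a i n) x * v n)"
        using sum[of i] i by (simp add: eq_neg_iff_add_eq_0 add.commute)
      also have "(\<Sum>j\<in>I. poly (a n j) x * v j) = - (poly (a n n) x * v n)"
        using sum[of n] by (simp add: eq_neg_iff_add_eq_0 add.commute)
      finally show ?thesis by (simp add: algebra_simps)
    qed
    show ?thesis by (rule insert.IH[OF True zero ov diag off])
  qed
qed

lemma integral_poly:
  assumes D: "integrally_closed D" and x: "x \<in> QF D"
    and p: "poly_over D p" "lead_coeff p = 1" "poly p x = 0"
  shows "x \<in> D"
proof -
  have "poly p x = (\<Sum>i\<le>degree p. coeff p i * x ^ i)" by (rule poly_altdef)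
  also have "\<dots> = x ^ degree p + (\<Sum>i<degree p. coeff p i * x ^ i)"
    using p(2) by (simp add: lessThan_Suc_atMost[symmetric] add.commute)
  finally have "x ^ degree p + (\<Sum>i<degree p. coeff p i * x ^ i) = 0" using p(3) by simp
  then show ?thesis using D x p(1) unfolding integrally_closed_def poly_over_def by blast
qed

text \<open>The determinant trick, with the elements of S themselves as the vector of unknowns; the
  nonzero member \<open>s0\<close> makes the solution nontrivial.\<close>

lemma integrally_closed_multiplier:
  assumes D: "dom_in D" "integrally_closed D" and S: "finite S" "s0 \<in> S" "s0 \<noteq> 0"
    and x: "x \<in> QF D" "\<And>s. s \<in> S \<Longrightarrow> x * s \<in> span_in D S"
  shows "x \<in> D"
proof -
  have "\<exists>c. (\<forall>t\<in>S. c t \<in> D) \<and> x * s = (\<Sum>t\<in>S. c t * t)" if s: "s \<in> S" for s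
  proof -
    obtain F c where F: "finite F" "F \<subseteq> S" "\<forall>t\<in>F. c t \<in> D" "x * s = (\<Sum>t\<in>F. c t * t)"
      using x(2)[OF s] unfolding span_in_def by blast
    have "(\<Sum>t\<in>F. c t * t) = (\<Sum>t\<in>S. (if t \<in> F then c t else 0) * t)"
      by (rule sum.mono_neutral_cong_left[OF S(1) F(2)]) auto
    then show ?thesis using F(3,4) dom_zero[OF D(1)]
      by (intro exI[of _ "\<lambda>t. if t \<in> F then c t else 0"]) auto
  qed
  then obtain c where c: "\<And>s t. s \<in> S \<Longrightarrow> t \<in> S \<Longrightarrow> c s t \<in> D"
    "\<And>s. s \<in> S \<Longrightarrow> x * s = (\<Sum>t\<in>S. c s t * t)" by metis
  \<comment> \<open>The characteristic matrix of c: evaluated at x it annihilates the vector of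
    elements of S, and the elimination starts with k = 1.\<close>
  define a where "a s t = [:- c s t, if s = t then 1 else 0:]" for s t
  have zero: "(\<Sum>t\<in>S. poly (a s t) x * t) = 0" if s: "s \<in> S" for s
  proof -
    have "(\<Sum>t\<in>S. poly (a s t) x * t) = (\<Sum>t\<in>S. (if s = t then x * s else 0) - c s t * t)"
      by (rule sum.cong) (auto simp: a_def algebra_simps)
    also have "\<dots> = x * s - (\<Sum>t\<in>S. c s t * t)" using S(1) s by (simp add: sum_subtractf)
    finally show ?thesis using c(2)[OF s] by simp
  qed
  have over: "poly_over D (a s t)" if "s \<in> S" "t \<in> S" for s t
    using c(1)[OF that] dom_in_mem[OF D(1)]
    by (auto simp: poly_over_def a_def coeff_pCons split: nat.splits)
  have diag: "lead_coeff (a s s) = 1 \<and> degree (a s s) = 1" if "s \<in> S" for s by (simp add: a_def)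
  have off: "degree (a s t) < 1" if "s \<in> S" "t \<in> S" "s \<noteq> t" for s t using that(3) by (simp add: a_def)
  have "\<exists>s\<in>S. s \<noteq> 0" using S(2,3) by blast
  from elimination_integral[OF D(1) S(1) this zero over diag off]
  obtain p where "poly_over D p" "lead_coeff p = 1" "poly p x = 0" by blast
  then show ?thesis by (rule integral_poly[OF D(2) x(1)])
qed

lemma integrally_closed_Eo_fg:
  assumes D: "dom_in D" "integrally_closed D" and I: "is_ideal D I" "fg_nonzero D I"
  shows "Eo D I = D"
proof
  obtain S where S: "finite S" "I = span_in D S" "I \<noteq> {0}" using I(2) unfolding fg_nonzero_def by blast
  have sI: "submod D I" using I(1) by (simp add: is_ideal_iff)
  have "\<exists>s0\<in>S. s0 \<noteq> 0"
  proof (rule ccontr)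
    assume "\<not> ?thesis"
    then have "I \<subseteq> {0}" unfolding S(2) by (intro span_least submodI) auto
    then show False using S(3) submod_zero[OF sI] by blast
  qed
  then obtain s0 where s0: "s0 \<in> S" "s0 \<noteq> 0" by blast
  show "Eo D I \<subseteq> D"
  proof
    fix x assume x: "x \<in> Eo D I"
    show "x \<in> D"
      using x span_superset[OF D(1), of S] S(2) unfolding Eo_def
      by (intro integrally_closed_multiplier[OF D S(1) s0]) (auto dest: colonD)
  qed
  show "D \<subseteq> Eo D I"
    unfolding Eo_def using sub_QF[OF D(1)] submod_mult[OF sI] by (intro subsetI colonI) auto
qed

section \<open>Invertibility from divisoriality or stability\<close>

lemma prod_colon_sub:
  assumes "dom_in D"
  shows "prod_in D I (colon D D I) \<subseteq> D"
  by (rule prod_least[OF submod_self[OF assms]]) (metis colonD(1) mult.commute)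

text \<open>If z carries I (D : I) into D, then zI lies in the v-closure of I, which is I, so z is
  in (I : I) = D. The product thus has no multipliers into D outside D.\<close>

lemma v_op_prod_colon:
  assumes D: "dom_in D" and I: "I \<subseteq> QF D" "v_op D I = I" "Eo D I = D"
  shows "1 \<in> v_op D (prod_in D I (colon D D I))"
  unfolding v_op_iff
proof (intro conjI ballI impI)
  show "1 \<in> QF D" using dom_one[OF D] sub_QF[OF D] by blast
  fix z assume z: "z \<in> QF D" "\<forall>s\<in>prod_in D I (colon D D I). z * s \<in> D"
  have "z \<in> Eo D I" unfolding Eo_def
  proof (rule colonI[OF z(1)])
    fix i assume i: "i \<in> I"
    have "z * i \<in> v_op D I" unfolding v_op_def
    proof (rule colonI)
      show "z * i \<in> QF D" using z(1) i I(1) by (intro dom_mult[OF dom_in_QF[OF D]]) auto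
      fix y assume "y \<in> colon D D I"
      then show "z * i * y \<in> D" using z(2) prod_mem[OF D i] by (simp add: mult.assoc)
    qed
    then show "z * i \<in> I" using I(2) by simp
  qed
  then show "1 * z \<in> D" using I(3) by simp
qed

text \<open>Divisoriality is used twice: for I, to put 1 into the v-closure of I (D : I), and for
  this product itself, to remove the v-closure.\<close>

lemma divisorial_imp_Prufer:
  assumes D: "dom_in D" "integrally_closed D" "divisorial D"
  shows "Prufer D"
  unfolding Prufer_def
proof (intro allI impI)
  fix I assume "is_ideal D I \<and> fg_nonzero D I"
  then have I: "is_ideal D I" "fg_nonzero D I" "I \<noteq> {0}" by (auto simp: fg_nonzero_def)
  let ?P = "prod_in D I (colon D D I)"
  have IQ: "I \<subseteq> D" "I \<subseteq> QF D" using I(1) sub_QF[OF D(1)] by (auto simp: is_ideal_iff)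
  have "v_op D I = I" using D(3) I unfolding divisorial_def by blast
  then have one: "1 \<in> v_op D ?P" by (rule v_op_prod_colon[OF D(1) IQ(2) _ integrally_closed_Eo_fg[OF D(1,2) I(1,2)]])
  have P: "is_ideal D ?P" unfolding is_ideal_iff using prod_colon_sub[OF D(1)] submod_prod[OF D(1)] by blast
  have "1 \<in> colon D D I" using dom_one[OF D(1)] sub_QF[OF D(1)] IQ by (intro colonI) auto
  then have "i \<in> ?P" if "i \<in> I" for i using prod_mem[OF D(1) that, of 1] by simp
  moreover have "0 \<in> I" using I(1) by (simp add: is_ideal_def)
  ultimately have "?P \<noteq> {0}" using I(3) by blast
  then have "v_op D ?P = ?P" using D(3) P unfolding divisorial_def by blast
  then show "?P = D" using ideal_eq_whole[OF P] one by simp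
qed

lemma stable_imp_Prufer:
  assumes D: "dom_in D" "integrally_closed D" "stable D"
  shows "Prufer D"
  unfolding Prufer_def
proof (intro allI impI)
  fix I assume "is_ideal D I \<and> fg_nonzero D I"
  then have I: "is_ideal D I" "fg_nonzero D I" "I \<noteq> {0}" by (auto simp: fg_nonzero_def)
  then show "prod_in D I (colon D D I) = D"
    using D(3) integrally_closed_Eo_fg[OF D(1,2) I(1,2)] unfolding stable_def by metis
qed

section \<open>The w-versions, and integral closedness of R and T\<close>

context proper_domain
begin

text \<open>W need not be finitely generated, so the determinant trick does not apply to it
  directly. At each M a common multiplier u outside M brings the finitely many x s back into the
  span; then u x lies in R, and R is w-closed.\<close>

lemma integrally_closed_Eo_w_op:
  assumes ic: "integrally_closed R" and S: "finite S" "S \<subseteq> R" "s0 \<in> S" "s0 \<noteq> 0"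
  defines "W \<equiv> w_op R (span_in R S)"
  shows "w_ideal R W" "S \<subseteq> W" "Eo R W = R"
proof -
  have sp: "submod R (span_in R S)" "S \<subseteq> span_in R S" "span_in R S \<subseteq> R"
    using submod_span[OF dom] span_superset[OF dom] span_least[OF submod_self[OF dom] S(2)] by blast+
  have spQ: "span_in R S \<subseteq> QF R" using sp(3) sub_QF[OF dom] by blast
  show W: "w_ideal R W" unfolding W_def
  proof (rule w_ideal_w_op)
    show "is_ideal R (span_in R S)" unfolding is_ideal_iff using sp by blast
    show "span_in R S \<noteq> {0}" using sp(2) S(3,4) by blast
  qed
  note D = w_idealD[OF W]
  show SW: "S \<subseteq> W" unfolding W_def using sp(2) w_op_superset[OF spQ] by blast
  show "Eo R W = R"
  proof
    show "R \<subseteq> Eo R W"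
      unfolding Eo_def using sub_QF[OF dom] submod_mult[OF D(2)] by (intro subsetI colonI) auto
    show "Eo R W \<subseteq> R"
    proof
      fix x assume x: "x \<in> Eo R W"
      then have xQ: "x \<in> QF R" unfolding Eo_def by (rule colonD)
      have "\<exists>u\<in>R - M. u * x \<in> R" if M: "M \<in> t_Max R" for M
      proof -
        have one: "1 \<in> R - M" using dom_one[OF dom] t_MaxD(4)[OF M] by blast
        have "\<exists>u\<in>R - M. \<forall>s\<in>F. u * (x * s) \<in> span_in R S" if "finite F" "F \<subseteq> S" for F
          using that
        proof (induction F rule: finite_induct)
          case empty
          then show ?case using one by blast
        next
          case (insert s F)
          then obtain u where u: "u \<in> R - M" "\<And>s. s \<in> F \<Longrightarrow> u * (x * s) \<in> span_in R S" by blast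
          have "s \<in> W" using insert.prems SW by blast
          then have "x * s \<in> W" using x colonD(1) unfolding Eo_def by blast
          then obtain w where w: "w \<in> R - M" "w * (x * s) \<in> span_in R S"
            unfolding W_def w_op_iff using M by blast
          have "w * u \<in> R - M"
            using t_Max_prime[OF M] u(1) w(1) dom_mult[OF dom] unfolding prime_ideal_def by blast
          moreover have "w * u * (x * t) \<in> span_in R S" if t: "t \<in> insert s F" for t
          proof (cases "t = s")
            case True
            then show ?thesis using submod_mult[OF sp(1) _ w(2), of u] u(1) by (simp add: mult_ac)
          next
            case False
            then show ?thesis using submod_mult[OF sp(1) _ u(2), of w t] w(1) t by (simp add: mult_ac)
          qed
          ultimately show ?case by blast
        qed
        from this[OF S(1) order_refl]
        obtain u where u: "u \<in> R - M" "\<And>s. s \<in> S \<Longrightarrow> u * (x * s) \<in> span_in R S" by blast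
        have "u * x \<in> QF R" using u(1) xQ sub_QF[OF dom] by (intro dom_mult[OF dom_in_QF[OF dom]]) auto
        then have "u * x \<in> R"
          by (rule integrally_closed_multiplier[OF dom ic S(1,3,4)]) (simp add: u(2) mult.assoc)
        then show ?thesis using u(1) by blast
      qed
      then have "x \<in> w_op R R" unfolding w_op_iff using xQ by blast
      then show "x \<in> R" unfolding w_op_R .
    qed
  qed
qed

text \<open>The counterpart inside R of \<open>Prufer_RX_imp_PvMD\<close>: if y a is outside M for a
  multiplier y, then y a is itself the required u, because (y a)(b / a) = y b; likewise for y
  b.\<close>

lemma PvMD_criterion:
  assumes "\<And>a b. a \<in> R \<Longrightarrow> b \<in> R \<Longrightarrow> a \<noteq> 0 \<Longrightarrow>
    1 \<in> w_op R (prod_in R (w_op R (span_in R {a, b})) (colon R R (w_op R (span_in R {a, b}))))"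
  shows "PvMD R"
  unfolding PvMD_iff
proof (intro ballI impI)
  fix M a b assume M: "M \<in> t_Max R" and ab: "a \<in> R" "b \<in> R" "a \<noteq> 0" "b \<noteq> 0"
  let ?I = "span_in R {a, b}" and ?W = "w_op R (span_in R {a, b})"
  have sM: "submod R M" by (rule t_MaxD(2)[OF M])
  have "?I \<subseteq> R" by (rule span_least[OF submod_self[OF dom]]) (use ab in auto)
  then have "?I \<subseteq> ?W" using w_op_superset sub_QF[OF dom] by blast
  then have abW: "a \<in> ?W" "b \<in> ?W" using span_superset[OF dom, of "{a, b}"] by auto
  obtain u where u: "u \<in> R - M" "u * 1 \<in> prod_in R ?W (colon R R ?W)"
    using assms[OF ab(1-3)] M unfolding w_op_iff by blast
  have "\<exists>y\<in>colon R R ?W. y * a \<notin> M \<or> y * b \<notin> M"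
  proof (rule ccontr)
    assume neg: "\<not> ?thesis"
    have "prod_in R ?W (colon R R ?W) \<subseteq> M"
    proof (rule prod_least[OF sM])
      fix i y assume i: "i \<in> ?W" and y: "y \<in> colon R R ?W"
      have "submod R {i. y * i \<in> M}"
        using submod_zero[OF sM] submod_add[OF sM] submod_mult[OF sM]
        by (intro submodI) (simp_all add: distrib_left mult.left_commute[of y])
      then have sub: "?I \<subseteq> {i. y * i \<in> M}" using neg y by (intro span_least) auto
      \<comment> \<open>Elements of the w-closure reach the span only after multiplication by some w
        outside M, which primeness of M removes again.\<close>
      obtain w where w: "w \<in> R - M" "w * i \<in> ?I" using i M unfolding w_op_iff by blast
      have "y * (w * i) \<in> M" using sub w(2) by blast
      then have "w * (i * y) \<in> M" by (simp add: mult_ac)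
      moreover have "i * y \<in> R" using colonD(1)[OF y i] by (simp add: mult.commute)
      ultimately show "i * y \<in> M" using t_Max_prime[OF M] w(1) unfolding prime_ideal_def by blast
    qed
    then show False using u by auto
  qed
  then obtain y where y: "y \<in> colon R R ?W" "y * a \<notin> M \<or> y * b \<notin> M" by blast
  have yR: "y * a \<in> R" "y * b \<in> R" using colonD(1)[OF y(1)] abW by blast+
  have "(y * a) * (b / a) = y * b" "(y * b) * (a / b) = y * a" using ab by simp_all
  then show "\<exists>u\<in>R - M. u * (a / b) \<in> R \<or> u * (b / a) \<in> R"
    using y(2) yR by (metis DiffI)
qed

text \<open>As in \<open>divisorial_imp_Prufer\<close>, except that the product must be replaced by
  its w-closure before the hypothesis applies to it.\<close>

lemma w_divisorial_imp_PvMD: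
  assumes ic: "integrally_closed R" and wd: "w_divisorial R"
  shows "PvMD R"
proof (rule PvMD_criterion)
  fix a b assume ab: "a \<in> R" "b \<in> R" "a \<noteq> 0"
  let ?W = "w_op R (span_in R {a, b})"
  have "finite {a, b}" "{a, b} \<subseteq> R" "a \<in> {a, b}" using ab by auto
  note W = integrally_closed_Eo_w_op[OF ic this ab(3)]
  note D = w_idealD[OF W(1)]
  let ?P = "prod_in R ?W (colon R R ?W)"
  have "v_op R ?W = ?W" using wd W(1) unfolding w_divisorial_def by blast
  then have one: "1 \<in> v_op R ?P" by (rule v_op_prod_colon[OF dom D(4) _ W(3)])
  have P: "is_ideal R ?P" unfolding is_ideal_iff using prod_colon_sub[OF dom] submod_prod[OF dom] by blast
  have "1 \<in> colon R R ?W" using dom_one[OF dom] sub_QF[OF dom] D(3) by (intro colonI) auto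
  then have "a * 1 \<in> ?P" using W(2) by (intro prod_mem[OF dom]) auto
  then have "?P \<noteq> {0}" using ab(3) by auto
  then have wP: "w_ideal R (w_op R ?P)" by (rule w_ideal_w_op[OF P])
  have "?P \<subseteq> QF R" using P sub_QF[OF dom] by (auto simp: is_ideal_iff)
  then have "v_op R ?P \<subseteq> v_op R (w_op R ?P)" by (intro v_op_mono w_op_superset)
  also have "v_op R (w_op R ?P) = w_op R ?P" using wd wP unfolding w_divisorial_def by blast
  finally show "1 \<in> w_op R ?P" using one by blast
qed

lemma w_stable_imp_PvMD:
  assumes ic: "integrally_closed R" and ws: "w_stable R"
  shows "PvMD R"
proof (rule PvMD_criterion)
  fix a b assume ab: "a \<in> R" "b \<in> R" "a \<noteq> 0"
  let ?W = "w_op R (span_in R {a, b})"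
  have "finite {a, b}" "{a, b} \<subseteq> R" "a \<in> {a, b}" using ab by auto
  note W = integrally_closed_Eo_w_op[OF ic this ab(3)]
  have "w_op R (prod_in R ?W (colon R (Eo R ?W) ?W)) = Eo R ?W"
    using ws W(1) unfolding w_stable_def by blast
  then show "1 \<in> w_op R (prod_in R ?W (colon R R ?W))" unfolding W(3) using dom_one[OF dom] by simp
qed

text \<open>An integral equation over R becomes one over T through \<open>emb\<close>, and T meets
  the field in R.\<close>

lemma integrally_closed_of_RX:
  assumes "integrally_closed (RX R)"
  shows "integrally_closed R"
  unfolding integrally_closed_def
proof (intro ballI impI)
  fix x assume x: "x \<in> QF R" and "\<exists>n c. (\<forall>i<n. c i \<in> R) \<and> x ^ n + (\<Sum>i<n. c i * x ^ i) = 0"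
  then obtain n c where c: "\<forall>i<n. c i \<in> R" "x ^ n + (\<Sum>i<n. c i * x ^ i) = 0" by blast
  have "emb (x ^ n + (\<Sum>i<n. c i * x ^ i)) = 0" unfolding c(2) by simp
  then have "emb x ^ n + (\<Sum>i<n. emb (c i) * emb x ^ i) = 0" by (simp add: emb_sum)
  moreover have "\<forall>i<n. emb (c i) \<in> RX R" using c(1) RX_emb by blast
  ultimately have "\<exists>n d. (\<forall>i<n. d i \<in> RX R) \<and> emb x ^ n + (\<Sum>i<n. d i * emb x ^ i) = 0"
    by (intro exI[of _ n] exI[of _ "\<lambda>i. emb (c i)"] conjI)
  then have "emb x \<in> RX R" using assms emb_QF[OF x] unfolding integrally_closed_def by blast
  then show "x \<in> R" unfolding emb_RX_iff .
qed

text \<open>Write the fraction as \<open>a' / b'\<close> with \<open>p a' + q b' = 1\<close>; integrality makes \<open>b'\<close> divide \<open>a' ^ n\<close>,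
  hence \<open>b'\<close> is a unit.\<close>

lemma PvMD_integrally_closed_RX:
  assumes V: "PvMD R"
  shows "integrally_closed (RX R)"
  unfolding integrally_closed_def
proof (intro ballI impI)
  let ?T = "RX R"
  note sT = submod_self[OF dom_RX]
  fix x assume x: "x \<in> QF ?T" and "\<exists>n c. (\<forall>i<n. c i \<in> ?T) \<and> x ^ n + (\<Sum>i<n. c i * x ^ i) = 0"
  then obtain n c where c: "\<forall>i<n. c i \<in> ?T" "x ^ n + (\<Sum>i<n. c i * x ^ i) = 0" by blast
  obtain a b where ab: "a \<in> ?T" "b \<in> ?T" "b \<noteq> 0" "x = a / b" using x by (rule QF_E)
  obtain p q s t where e: "p \<in> ?T" "q \<in> ?T" "s \<in> ?T" "t \<in> ?T"
    "a = s * (p * a + q * b)" "b = t * (p * a + q * b)"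
    using PvMD_RX_Bezout[OF V ab(1,2)] by blast
  \<comment> \<open>Removing the common divisor d leaves the reduced numerator s and denominator t;
    cancelling d yields p s + q t = 1.\<close>
  define d where "d = p * a + q * b"
  have ad: "a = s * d" "b = t * d" using e(5,6) by (simp_all add: d_def)
  then have d0: "d \<noteq> 0" and t0: "t \<noteq> 0" using ab(3) by auto
  have "d = p * (s * d) + q * (t * d)" by (simp only: ad[symmetric]) (rule d_def)
  then have "(p * s + q * t) * d = 1 * d" by (simp only: distrib_right mult.assoc mult_1)
  then have pq: "p * s + q * t = 1" using d0 by (simp only: mult_cancel_right simp_thms)
  have xs: "x = s / t" unfolding ab(4) ad(1) ad(2) using d0 by simp
  have xt: "x * t = s" using xs t0 by simp
  have n: "n \<noteq> 0" using c(2) by (cases n) auto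
  have eq: "x ^ i * t ^ (n - 1) = s ^ i * t ^ (n - 1 - i)" if "i < n" for i
  proof -
    have "t ^ (n - 1) = t ^ i * t ^ (n - 1 - i)" using that by (simp flip: power_add)
    then show ?thesis unfolding xt[symmetric] by (simp add: power_mult_distrib mult_ac)
  qed
  \<comment> \<open>Multiplying the integral equation by \<open>t ^ (n - 1)\<close> clears all lower
    terms and leaves a single factor x in the leading one.\<close>
  have "x * s ^ (n - 1) = x ^ n * t ^ (n - 1)"
    unfolding xt[symmetric] using n by (cases n) (simp_all add: power_mult_distrib mult.assoc)
  also have "x ^ n = - (\<Sum>i<n. c i * x ^ i)" using c(2) by (simp add: eq_neg_iff_add_eq_0)
  also have "- (\<Sum>i<n. c i * x ^ i) * t ^ (n - 1) = - (\<Sum>i<n. c i * (s ^ i * t ^ (n - 1 - i)))"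
    unfolding sum_distrib_right minus_mult_left[symmetric] mult.assoc
    by (intro arg_cong[of _ _ uminus] sum.cong refl) (simp only: eq lessThan_iff)
  also have "\<dots> \<in> ?T"
    using c(1) e(3,4) by (intro dom_uminus[OF dom_RX] submod_sum[OF sT] dom_mult[OF dom_RX] dom_power[OF dom_RX]) auto
  finally have top: "x * s ^ (n - 1) \<in> ?T" .
  \<comment> \<open>By p s + q t = 1 and x t = s the factors s are removed one at a time.\<close>
  have down: "x * s ^ k \<in> ?T" if "x * s ^ Suc k \<in> ?T" for k
  proof -
    have "x * s ^ k = x * s ^ k * (p * s + q * t)" using pq by simp
    also have "\<dots> = p * (x * s ^ Suc k) + q * s ^ k * (x * t)" by (simp add: algebra_simps)
    finally show ?thesis
      unfolding xt using that e(1-3)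
      by (simp only: dom_add[OF dom_RX] dom_mult[OF dom_RX] dom_power[OF dom_RX])
  qed
  have "x * s ^ k \<in> ?T \<Longrightarrow> x \<in> ?T" for k by (induction k) (simp, metis down)
  then show "x \<in> ?T" using top by blast
qed

end

section \<open>The six equivalences\<close>

theorem theorem2p12:
  fixes R :: "'a::field set"
  assumes "dom_in R" and "QF R \<noteq> R"
  shows "(t_finite_character R \<longleftrightarrow> finite_character (RX R))
    \<and> (weakly_Matlis R \<and> PvMD R \<longleftrightarrow> h_local (RX R) \<and> Prufer (RX R))
    \<and> (strongly_discrete_PvMD R \<longleftrightarrow> strongly_discrete_Prufer (RX R))
    \<and> (generalized_Krull R \<longleftrightarrow> generalized_Dedekind (RX R))
    \<and> (integrally_closed R \<and> w_divisorial R \<longleftrightarrow> integrally_closed (RX R) \<and> divisorial (RX R))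
    \<and> (integrally_closed R \<and> w_stable R \<longleftrightarrow> integrally_closed (RX R) \<and> stable (RX R))"
proof -
  interpret proper_domain R using assms by unfold_locales
  have sd: "strongly_discrete_PvMD R \<longleftrightarrow> strongly_discrete_Prufer (RX R)"
  proof (cases "PvMD R")
    case True
    then show ?thesis by (rule PvMD_strongly_discrete_iff)
  next
    case False
    then show ?thesis
      by (simp add: strongly_discrete_PvMD_def strongly_discrete_Prufer_def PvMD_iff_Prufer_RX)
  qed
  have gk: "generalized_Krull R \<longleftrightarrow> generalized_Dedekind (RX R)"
  proof (cases "PvMD R")
    case True
    then show ?thesis
      unfolding generalized_Krull_def generalized_Dedekind_def sd PvMD_acc_radical_iff[OF True] by simp
  next
    case False
    then show ?thesis
      unfolding generalized_Krull_def generalized_Dedekind_def sd[symmetric]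
      by (simp add: strongly_discrete_PvMD_def)
  qed
  have ic: "integrally_closed R \<longleftrightarrow> integrally_closed (RX R)" if "PvMD R"
    using PvMD_integrally_closed_RX[OF that] integrally_closed_of_RX by simp
  have dv: "integrally_closed R \<and> w_divisorial R \<longleftrightarrow> integrally_closed (RX R) \<and> divisorial (RX R)"
  proof (cases "PvMD R")
    case True
    then show ?thesis by (simp add: ic PvMD_divisorial_iff)
  next
    case False
    then show ?thesis
      using w_divisorial_imp_PvMD Prufer_RX_imp_PvMD[OF divisorial_imp_Prufer[OF dom_RX]] by blast
  qed
  have st: "integrally_closed R \<and> w_stable R \<longleftrightarrow> integrally_closed (RX R) \<and> stable (RX R)"
  proof (cases "PvMD R")
    case True
    then show ?thesis by (simp add: ic PvMD_stable_iff)
  next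
    case False
    then show ?thesis
      using w_stable_imp_PvMD Prufer_RX_imp_PvMD[OF stable_imp_Prufer[OF dom_RX]] by blast
  qed
  have wm: "weakly_Matlis R \<and> PvMD R \<longleftrightarrow> h_local (RX R) \<and> Prufer (RX R)"
    using PvMD_weakly_Matlis_iff PvMD_iff_Prufer_RX by blast
  show ?thesis by (intro conjI finite_character_iff wm sd gk dv st)
qed

end
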